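(* Every finite set of points $P \subset \mathbb{R}^2$, equipped with the Euclidean metric, admits a spanning tree cover consisting of two trees and with stretch $4\sqrt{26}$.
   Context: A $t$-tree cover (tree cover with stretch $t\ge 1$) of a metric space $(X,\|\cdot\|_X)$ is a set $\mathcal{T}$ of edge-weighted trees such that $X\subseteq V(T')$ for every $T'\in\mathcal{T}$, and for every two points $x,y\in X$ there exists a tree $T\in\mathcal{T}$ with $\|xy\|_X\le d_T(x,y)\le t\cdot\|xy\|_X$, where $d_T$ is the (weighted) shortest-path distance in $T$. The tree cover is spanning if every tree in $\mathcal{T}$ is a spanning tree of the metric, i.e., its vertex set is exactly $X$ (no additional Steiner points) and each edge $\{x,y\}$ has weight $\|xy\|_X$. For $P\subset\mathbb{R}^2$ the metric is the Euclidean distance restricted to $P$. *)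

theory Defs
  imports
    "HOL-Analysis.Analysis"
    "Graph_Theory.Pair_Digraph"
    "Graph_Theory.Shortest_Path"
begin

(* A simple undirected graph is represented, as usual in Graph_Theory, by a symmetric loop-free
   digraph: an edge {u,v} is the pair of arcs (u,v), (v,u). *)
type_synonym 'a weighted_graph = "'a pair_pre_digraph \<times> ('a \<times> 'a) weight_fun"

(* Digraph_Component.tree is not the undirected notion: it forbids directed cycles only, so a
   bidirected edge is not a tree, whereas the DAG a->b->d, a->c->d is one. In a symmetric loop-free
   digraph without parallel arcs, the undirected cycles are the directed cycles with at least three
   arcs (those with two arcs traverse a single edge back and forth).
   The graph without vertices counts as a tree, so that the empty metric space is not exceptional. *)
definition undirected_tree :: "'a pair_pre_digraph \<Rightarrow> bool" where
  "undirected_tree G \<longleftrightarrow>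
     pair_bidirected_digraph G \<and>
     (\<forall>u\<in>pverts G. \<forall>v\<in>pverts G. u \<rightarrow>\<^sup>*\<^bsub>with_proj G\<^esub> v) \<and>
     \<not> (\<exists>p. pre_digraph.cycle (with_proj G) p \<and> 3 \<le> length p)"

definition weighted_tree :: "'a weighted_graph \<Rightarrow> bool" where
  "weighted_tree T \<longleftrightarrow>
     undirected_tree (fst T) \<and>
     (\<forall>(u, v)\<in>parcs (fst T). 0 \<le> snd T (u, v) \<and> snd T (u, v) = snd T (v, u))"

(* The shortest-path distance; extended-real valued since wf_digraph.\<mu> is an infimum over walks. *)
definition tree_dist :: "'a weighted_graph \<Rightarrow> 'a \<Rightarrow> 'a \<Rightarrow> ereal" where
  "tree_dist T = wf_digraph.\<mu> (with_proj (fst T)) (snd T)"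

context Metric_space
begin

(* The trees may have Steiner vertices, i.e. elements of the type 'a outside M. *)
definition tree_cover :: "real \<Rightarrow> 'a weighted_graph set \<Rightarrow> bool" where
  "tree_cover t \<T> \<longleftrightarrow>
     1 \<le> t \<and>
     (\<forall>T\<in>\<T>. weighted_tree T \<and> M \<subseteq> pverts (fst T)) \<and>
     (\<forall>x\<in>M. \<forall>y\<in>M. \<exists>T\<in>\<T>.
        ereal (d x y) \<le> tree_dist T x y \<and> tree_dist T x y \<le> ereal (t * d x y))"

definition spanning_tree_cover :: "real \<Rightarrow> 'a weighted_graph set \<Rightarrow> bool" where
  "spanning_tree_cover t \<T> \<longleftrightarrow>
     tree_cover t \<T> \<and>
     (\<forall>T\<in>\<T>. pverts (fst T) = M \<and> (\<forall>(u, v)\<in>parcs (fst T). snd T (u, v) = d u v))"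

end

lemma Metric_space_dist: "Metric_space P (dist :: 'a::metric_space \<Rightarrow> 'a \<Rightarrow> real)"
  by unfold_locales (auto simp: dist_commute dist_triangle)

end

theory Submission
  imports Defs
begin

text \<open>Partition the plane hierarchically: three congruent rectangles of aspect ratio \<open>sqrt 3\<close>, placed
  side by side along their long sides, form a rectangle of the same shape, scaled by \<open>sqrt 3\<close> and
  rotated by a right angle. The first tree uses this hierarchy, the second one the same hierarchy
  shifted by half a rectangle in both directions on every level, so that the walls of one
  partition are the center lines of the other. In each tree the parts of a rectangle are linked near the
  midpoints of their common sides.

  Two points are treated in the tree in which their rectangles merge first. On the last level
  where they lie in different rectangles of that partition they are separated by the other
  partition as well, hence by a center line of their own one. If this center line is the axis along
  which the three rectangles are linked, both points are near it compared to their distance, and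
  otherwise their distance is at least half the width of a rectangle. In both cases the tree path has
  length at most \<open>9/4\<close> times the displacement in one coordinate plus \<open>81/4\<close> times that
  in the other, and Cauchy--Schwarz gives the stretch.\<close>

section \<open>Geometric trees as graphs\<close>

text \<open>Three parts are used because an odd number keeps the shifted hierarchy nested: the walls
  of the coarse grid shifted by half a cell are then walls of the fine grid shifted by half a cell.
  The ratio \<open>sqrt 3\<close> makes a part similar to the whole, so one list of inequalities
  serves every level.

  The obstacle is that the trees have to be spanning. The midpoints of the sides are no vertices,
  and any part may contain no points, so a rectangle is left through actual points whose distance to
  the midpoint must be controlled. The hard configuration is an empty middle part: the outer parts
  are then linked directly, and a single point has to serve both long sides of the whole, although
  it may be far from either. The choice of that point, and an alternative in the induction
  hypothesis that records what is known about such a point one level below, provide the small gain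
  without which the constants would not reproduce.\<close>

definition join_dist :: "'a set \<Rightarrow> ('a \<Rightarrow> 'a \<Rightarrow> real) \<Rightarrow> ('a \<Rightarrow> 'a \<Rightarrow> real) \<Rightarrow> 'a \<Rightarrow> 'a \<Rightarrow>
    'a \<Rightarrow> 'a::metric_space \<Rightarrow> real" where
  "join_dist V D1 D2 a b x y =
     (if x \<in> V then (if y \<in> V then D1 x y else D1 x a + dist a b + D2 b y)
      else (if y \<in> V then D2 x b + dist a b + D1 a y else D2 x y))"

text \<open>Trees grow by one bridge between two disjoint trees, which makes acyclicity an
  induction. \<open>D\<close> carries the path length along as an explicit formula, so the geometric
  estimates never mention walks.\<close>

inductive mtree :: "'a::metric_space set \<Rightarrow> ('a \<times> 'a) set \<Rightarrow> ('a \<Rightarrow> 'a \<Rightarrow> real) \<Rightarrow> bool" where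
  single: "mtree {v} {} (\<lambda>_ _. 0)"
| join: "mtree V1 E1 D1 \<Longrightarrow> mtree V2 E2 D2 \<Longrightarrow> V1 \<inter> V2 = {} \<Longrightarrow> a \<in> V1 \<Longrightarrow> b \<in> V2 \<Longrightarrow>
    mtree (V1 \<union> V2) (E1 \<union> E2 \<union> {(a, b), (b, a)}) (join_dist V1 D1 D2 a b)"

lemma mtree_edges:
  assumes "mtree V E D"
  shows "E \<subseteq> V \<times> V \<and> sym E \<and> irrefl E"
  using assms by induction (auto simp: sym_def irrefl_def)

lemma mtree_dist_sym:
  assumes "mtree V E D"
  shows "\<forall>x\<in>V. \<forall>y\<in>V. D x y = D y x"
  using assms
proof induction
  case (join V1 E1 D1 V2 E2 D2 a b)
  have "y \<notin> V1" if "y \<in> V2" for y using that join by auto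
  with join show ?case by (auto simp: join_dist_def)
qed auto

lemma mtree_dist_self:
  assumes "mtree V E D"
  shows "\<forall>x\<in>V. D x x = 0"
  using assms by induction (auto simp: join_dist_def)

abbreviation edge_length :: "'a::metric_space \<times> 'a \<Rightarrow> real" where
  "edge_length \<equiv> \<lambda>(u, v). dist u v"

lemma pcas_append: "pcas u (p @ q) w \<longleftrightarrow> (\<exists>v. pcas u p v \<and> pcas v q w)"
  by (induction p arbitrary: u) auto

lemma mtree_walk:
  assumes "mtree V E D"
  shows "\<forall>x\<in>V. \<forall>y\<in>V. \<exists>p. set p \<subseteq> E \<and> pcas x p y \<and> sum_list (map edge_length p) = D x y"
  using assms
proof induction
  case (single v)
  show ?case by (auto intro!: exI[of _ "[]"])
next
  case (join V1 E1 D1 V2 E2 D2 a b)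
  let ?E = "E1 \<union> E2 \<union> {(a, b), (b, a)}"
  note IH1 = join.IH(1)[rule_format] and IH2 = join.IH(2)[rule_format]
  have nV1: "y \<notin> V1" if "y \<in> V2" for y using that join.hyps by auto
  show ?case
  proof (intro ballI)
    fix x y assume x: "x \<in> V1 \<union> V2" and y: "y \<in> V1 \<union> V2"
    consider "x \<in> V1" "y \<in> V1" | "x \<in> V1" "y \<in> V2" | "x \<in> V2" "y \<in> V1" | "x \<in> V2" "y \<in> V2"
      using x y by auto
    then show "\<exists>p. set p \<subseteq> ?E \<and> pcas x p y \<and> sum_list (map edge_length p) = join_dist V1 D1 D2 a b x y"
    proof cases
      case 1
      from IH1[OF this] show ?thesis using 1 by (auto simp: join_dist_def)
    next
      case 2
      obtain p where p: "set p \<subseteq> E1" "pcas x p a" "sum_list (map edge_length p) = D1 x a"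
        using IH1[OF 2(1) join.hyps(4)] by auto
      obtain q where q: "set q \<subseteq> E2" "pcas b q y" "sum_list (map edge_length q) = D2 b y"
        using IH2[OF join.hyps(5) 2(2)] by auto
      have "set (p @ (a, b) # q) \<subseteq> ?E \<and> pcas x (p @ (a, b) # q) y \<and>
          sum_list (map edge_length (p @ (a, b) # q)) = join_dist V1 D1 D2 a b x y"
        using p q 2 nV1 by (auto simp: pcas_append join_dist_def)
      then show ?thesis by blast
    next
      case 3
      obtain p where p: "set p \<subseteq> E2" "pcas x p b" "sum_list (map edge_length p) = D2 x b"
        using IH2[OF 3(1) join.hyps(5)] by auto
      obtain q where q: "set q \<subseteq> E1" "pcas a q y" "sum_list (map edge_length q) = D1 a y"
        using IH1[OF join.hyps(4) 3(2)] by auto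
      have "set (p @ (b, a) # q) \<subseteq> ?E \<and> pcas x (p @ (b, a) # q) y \<and>
          sum_list (map edge_length (p @ (b, a) # q)) = join_dist V1 D1 D2 a b x y"
        using p q 3 nV1 by (auto simp: pcas_append join_dist_def dist_commute)
      then show ?thesis by blast
    next
      case 4
      from IH2[OF this] show ?thesis using 4 nV1 by (auto simp: join_dist_def)
    qed
  qed
qed

text \<open>A cyclic sequence of \<open>n\<close> distinct vertices is encoded as an \<open>n\<close>-periodic sequence, so that
  no case distinction is needed where it closes up.\<close>
definition periodic_cycle :: "('a \<times> 'a) set \<Rightarrow> nat \<Rightarrow> (nat \<Rightarrow> 'a) \<Rightarrow> bool" where
  "periodic_cycle E n f \<longleftrightarrow>
     3 \<le> n \<and> (\<forall>i. (f i, f (Suc i)) \<in> E) \<and> (\<forall>i j. f i = f j \<longleftrightarrow> i mod n = j mod n)"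

lemma last_before_change:
  fixes P :: "nat \<Rightarrow> bool"
  assumes "P i" "\<not> P j" "i \<le> j"
  shows "\<exists>k\<ge>i. P k \<and> \<not> P (Suc k)"
proof (rule ccontr)
  assume "\<not> ?thesis"
  then have "\<And>k. i \<le> k \<Longrightarrow> P k \<Longrightarrow> P (Suc k)" by blast
  with assms(3,1) have "P j" by (induction rule: dec_induct) auto
  with assms(2) show False by simp
qed

text \<open>A cycle meeting both sides leaves \<open>V1\<close> and later returns, both times over
  the only bridge. It thus passes \<open>a\<close>, \<open>b\<close> and afterwards
  \<open>b\<close>, \<open>a\<close>, so two steps already close the sequence and its period divides
  2.\<close>

lemma mtree_acyclic:
  assumes "mtree V E D"
  shows "\<not> periodic_cycle E n f"
  using assms
proof (induction arbitrary: n f)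
  case (single v)
  show ?case by (auto simp: periodic_cycle_def)
next
  case (join V1 E1 D1 V2 E2 D2 a b)
  let ?E = "E1 \<union> E2 \<union> {(a, b), (b, a)}"
  have E1: "E1 \<subseteq> V1 \<times> V1" and E2: "E2 \<subseteq> V2 \<times> V2"
    using mtree_edges join.hyps by blast+
  show ?case
  proof
    assume c: "periodic_cycle ?E n f"
    then have n: "3 \<le> n" and e: "\<And>i. (f i, f (Suc i)) \<in> ?E"
      and p: "\<And>i j. f i = f j \<longleftrightarrow> i mod n = j mod n"
      unfolding periodic_cycle_def by auto
    have V: "f i \<in> V1 \<union> V2" for i
      using e[of i] E1 E2 join.hyps(4,5) by blast
    have per: "f (i + n * j) = f i" for i j using p by simp
    show False
    proof (cases "(\<forall>i. f i \<in> V1) \<or> (\<forall>i. f i \<in> V2)")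
      case True
      then show False
      proof
        assume "\<forall>i. f i \<in> V1"
        then have "(f i, f (Suc i)) \<in> E1" for i
          using e[of i] E2 join.hyps(3-5) by blast
        then show False using join.IH(1)[of n f] n p unfolding periodic_cycle_def by blast
      next
        assume "\<forall>i. f i \<in> V2"
        then have "(f i, f (Suc i)) \<in> E2" for i
          using e[of i] E1 join.hyps(3-5) by blast
        then show False using join.IH(2)[of n f] n p unfolding periodic_cycle_def by blast
      qed
    next
      case False
      then obtain i0 j0 where ij: "f i0 \<notin> V2" "f j0 \<notin> V1" by blast
      have "f i0 \<in> V1" using ij V by blast
      \<comment> \<open>Whole periods move \<open>j0\<close> past \<open>i0\<close>, so that the
        sequence leaves \<open>V1\<close> somewhere in between.\<close>
      moreover have "f (j0 + n * i0) \<notin> V1" using per ij by simp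
      moreover have "i0 \<le> j0 + n * i0" using n by (simp add: trans_le_add2)
      ultimately obtain i where i: "f i \<in> V1" "f (Suc i) \<notin> V1"
        using last_before_change[of "\<lambda>i. f i \<in> V1"] by blast
      then have ab: "f i = a" "f (Suc i) = b"
        using e[of i] E1 E2 join.hyps(3-5) by blast+
      have "Suc i \<le> i + n * 1" using n by simp
      moreover have "f (i + n * 1) \<in> V1" using per i by metis
      ultimately obtain k where k: "f k \<notin> V1" "f (Suc k) \<in> V1"
        using last_before_change[of "\<lambda>i. f i \<notin> V1"] i(2) by blast
      then have ba: "f k = b" "f (Suc k) = a"
        using e[of k] E1 E2 V[of k] join.hyps(3-5) by blast+
      have "Suc i mod n = k mod n" using ab ba p by metis
      then have "Suc (Suc i) mod n = Suc k mod n" by (metis mod_Suc_eq)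
      also have "\<dots> = i mod n" using ab ba p by metis
      finally have "(i + 2) mod n = i mod n" by simp
      then have "n dvd 2" by (metis add_diff_cancel_left' le_add1 mod_eq_dvd_iff_nat)
      then show False using n by (auto dest: dvd_imp_le)
    qed
  qed
qed

section \<open>From cycles of arcs to weighted trees\<close>

lemma pcas_nth:
  assumes "pcas u p v" "Suc i < length p"
  shows "snd (p ! i) = fst (p ! Suc i)"
  using assms
proof (induction u p v arbitrary: i rule: pcas.induct)
  case (2 u e es v)
  then show ?case by (cases i; cases es) auto
qed simp

lemma pcas_hd_last:
  assumes "pcas u p v" "p \<noteq> []"
  shows "fst (p ! 0) = u" "snd (p ! (length p - 1)) = v"
  using assms
proof (induction u p v rule: pcas.induct)
  case (2 u e es v)
  { case 1 then show ?case by simp }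
  { case 2 then show ?case using "2.IH" 2 by (cases es) auto }
qed auto

text \<open>The sequence lists the heads of the arcs; these are the vertices of the walk without the
  first one, exactly those that \<open>cycle\<close> requires to be distinct.\<close>

lemma cycle_imp_periodic_cycle:
  assumes "set p \<subseteq> E" "pcas u p u" "distinct (tl (pawalk_verts u p))" "3 \<le> length p"
  shows "periodic_cycle E (length p) (\<lambda>i. snd (p ! (i mod length p)))"
proof -
  let ?n = "length p"
  have "p \<noteq> []" using assms(4) by auto
  have tl: "tl (pawalk_verts u p) = map snd p"
  proof -
    have "pcas v p w \<Longrightarrow> pawalk_verts v p = v # map snd p" for v w
      by (induction p arbitrary: v) auto
    then show ?thesis using assms(2) by simp
  qed
  have *: "(snd (p ! (i mod ?n)), snd (p ! (Suc i mod ?n))) \<in> E" for i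
  proof -
    have lt: "Suc i mod ?n < ?n" using \<open>p \<noteq> []\<close> by simp
    have "snd (p ! (i mod ?n)) = fst (p ! (Suc i mod ?n))"
    proof (cases "Suc (i mod ?n) = ?n")
      case True
      then have "Suc i mod ?n = 0" by (simp add: mod_Suc)
      moreover have "i mod ?n = ?n - 1" using True by simp
      ultimately show ?thesis using pcas_hd_last[OF assms(2) \<open>p \<noteq> []\<close>] by simp
    next
      case False
      then have "Suc i mod ?n = Suc (i mod ?n)" by (simp add: mod_Suc)
      moreover from this lt have "Suc (i mod ?n) < ?n" by simp
      ultimately show ?thesis using pcas_nth[OF assms(2)] by simp
    qed
    then show ?thesis using nth_mem[OF lt] assms(1) by (metis prod.collapse subsetD)
  qed
  have "distinct (map snd p)" using assms(3) tl by simp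
  then have "snd (p ! (i mod ?n)) = snd (p ! (j mod ?n)) \<longleftrightarrow> i mod ?n = j mod ?n" for i j
    using \<open>p \<noteq> []\<close> nth_eq_iff_index_eq[of "map snd p" "i mod ?n" "j mod ?n"] by simp
  with * show ?thesis using assms(4) unfolding periodic_cycle_def by blast
qed

abbreviation metric_graph :: "'a::metric_space set \<Rightarrow> ('a \<times> 'a) set \<Rightarrow> 'a weighted_graph" where
  "metric_graph V E \<equiv> (\<lparr>pverts = V, parcs = E\<rparr>, edge_length)"

lemma dist_le_walk_cost: "pcas x p y \<Longrightarrow> dist x y \<le> sum_list (map edge_length p)"
proof (induction p arbitrary: x)
  case (Cons e p)
  then have "dist (snd e) y \<le> sum_list (map edge_length p)" "fst e = x" by auto
  then show ?case using dist_triangle[of x y "snd e"] by (auto simp: case_prod_unfold)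
qed simp

text \<open>The lower bound is the triangle inequality along an arbitrary walk. For the upper bound
  a single walk of cost \<open>D x y\<close> suffices, since the tree distance is an infimum over
  walks.\<close>

lemma
  assumes V: "E \<subseteq> V \<times> V" and s: "sym E" and i: "irrefl E"
    and conn: "\<And>x y. x \<in> V \<Longrightarrow> y \<in> V \<Longrightarrow>
      \<exists>p. set p \<subseteq> E \<and> pcas x p y \<and> sum_list (map edge_length p) = D x y"
    and acyc: "\<And>n f. \<not> periodic_cycle E n f"
  shows metric_graph_tree: "weighted_tree (metric_graph V E)"
    and metric_graph_dist_ge:
      "x \<in> V \<Longrightarrow> y \<in> V \<Longrightarrow> ereal (dist x y) \<le> tree_dist (metric_graph V E) x y"
    and metric_graph_dist_le:
      "x \<in> V \<Longrightarrow> y \<in> V \<Longrightarrow> tree_dist (metric_graph V E) x y \<le> ereal (D x y)"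
proof -
  let ?G = "\<lparr>pverts = V, parcs = E\<rparr>"
  interpret pair_bidirected_digraph ?G
  proof
    show "\<And>e. e \<in> parcs ?G \<Longrightarrow> fst e \<in> pverts ?G" "\<And>e. e \<in> parcs ?G \<Longrightarrow> snd e \<in> pverts ?G"
      using V by auto
    show "symmetric (with_proj ?G)" using s by (simp add: symmetric_def)
    show "\<And>e. e \<in> parcs ?G \<Longrightarrow> fst e \<noteq> snd e" using i by (auto simp: irrefl_def)
  qed
  have walk: "\<exists>p. awalk x p y \<and> awalk_cost edge_length p = D x y" if "x \<in> V" "y \<in> V" for x y
    using conn[OF that] that by (auto simp: awalk_def awalk_cost_def)
  have "\<not> (\<exists>p. cycle p \<and> 3 \<le> length p)"
  proof
    assume "\<exists>p. cycle p \<and> 3 \<le> length p"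
    then obtain p u where "set p \<subseteq> E" "pcas u p u" "distinct (tl (pawalk_verts u p))" "3 \<le> length p"
      unfolding cycle_def awalk_def by auto
    then show False by (rule acyc[THEN notE, OF cycle_imp_periodic_cycle])
  qed
  moreover have "\<forall>u\<in>V. \<forall>v\<in>V. u \<rightarrow>\<^sup>*\<^bsub>with_proj ?G\<^esub> v"
    using walk reachable_awalk by blast
  ultimately have "undirected_tree ?G"
    unfolding undirected_tree_def using pair_bidirected_digraph_axioms by simp
  then show "weighted_tree (metric_graph V E)"
    by (auto simp: weighted_tree_def dist_commute)
  assume xy: "x \<in> V" "y \<in> V"
  show "ereal (dist x y) \<le> tree_dist (metric_graph V E) x y"
    unfolding tree_dist_def fst_conv snd_conv \<mu>_def
    by (rule INF_greatest) (auto simp: awalk_def awalk_cost_def intro: dist_le_walk_cost)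
  show "tree_dist (metric_graph V E) x y \<le> ereal (D x y)"
    unfolding tree_dist_def fst_conv snd_conv
    using walk[OF xy] min_cost_le_walk_cost[of x _ y edge_length] by metis
qed

lemma mtree_metric_graph:
  assumes "mtree V E D"
  shows "weighted_tree (metric_graph V E)"
    and "x \<in> V \<Longrightarrow> y \<in> V \<Longrightarrow> ereal (dist x y) \<le> tree_dist (metric_graph V E) x y"
    and "x \<in> V \<Longrightarrow> y \<in> V \<Longrightarrow> tree_dist (metric_graph V E) x y \<le> ereal (D x y)"
proof -
  have e: "E \<subseteq> V \<times> V" "sym E" "irrefl E" using mtree_edges[OF assms] by auto
  note args = e mtree_walk[OF assms, rule_format] mtree_acyclic[OF assms]
  show "weighted_tree (metric_graph V E)"
    by (rule metric_graph_tree[OF args])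
  show "x \<in> V \<Longrightarrow> y \<in> V \<Longrightarrow> ereal (dist x y) \<le> tree_dist (metric_graph V E) x y"
    by (rule metric_graph_dist_ge[OF args])
  show "x \<in> V \<Longrightarrow> y \<in> V \<Longrightarrow> tree_dist (metric_graph V E) x y \<le> ereal (D x y)"
    by (rule metric_graph_dist_le[OF args])
qed

lemma empty_metric_graph: "weighted_tree (metric_graph {} {})"
  by (rule metric_graph_tree) (auto simp: sym_def irrefl_def periodic_cycle_def)

section \<open>Distances to holes\<close>

text \<open>The hole \<open>(p, l)\<close> is given by its coordinates because it need not be an
  element of the type.\<close>

definition hdist :: "('a \<Rightarrow> real) \<Rightarrow> ('a \<Rightarrow> real) \<Rightarrow> real \<Rightarrow> real \<Rightarrow> 'a \<Rightarrow> real" where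
  "hdist S L p l e = sqrt ((S e - p)\<^sup>2 + (L e - l)\<^sup>2)"

text \<open>The coordinates are parameters because short and long direction swap from level to
  level; the rotation by a right angle is then an exchange of arguments.\<close>

definition plane_coords :: "('a::metric_space \<Rightarrow> real) \<Rightarrow> ('a \<Rightarrow> real) \<Rightarrow> bool" where
  "plane_coords S L \<longleftrightarrow> (\<forall>x y. dist x y = sqrt ((S x - S y)\<^sup>2 + (L x - L y)\<^sup>2))"

lemma plane_coords_commute: "plane_coords S L \<Longrightarrow> plane_coords L S"
  by (simp add: plane_coords_def add.commute)

lemma hdist_commute: "hdist S L p l e = hdist L S l p e"
  by (simp add: hdist_def add.commute)

lemma hdist_nonneg: "0 \<le> hdist S L p l e"
  by (simp add: hdist_def)

lemma hdist_triangle: "hdist S L p l e \<le> hdist S L p' l' e + sqrt ((p' - p)\<^sup>2 + (l' - l)\<^sup>2)"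
  using real_sqrt_sum_squares_triangle_ineq[of "S e - p'" "p' - p" "L e - l'" "l' - l"]
  by (simp add: hdist_def)

lemma hdist_shift: "hdist S L p l e \<le> hdist S L p' l e + \<bar>p' - p\<bar>"
  using hdist_triangle[of S L p l e p' l] by simp

text \<open>A detour through the hole: an edge between two entries costs at most what both have
  already been charged.\<close>

lemma dist_le_hdist:
  assumes "plane_coords S L"
  shows "dist x y \<le> hdist S L p l x + hdist S L p l y"
proof -
  have "dist x y = hdist S L (S y) (L y) x"
    using assms by (simp add: plane_coords_def hdist_def)
  also have "\<dots> \<le> hdist S L p l x + hdist S L p l y"
    using hdist_triangle[of S L "S y" "L y" x p l] by (simp add: hdist_def power2_commute)
  finally show ?thesis .
qed

lemma dist_le_hdist':
  assumes "plane_coords S L"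
  shows "dist x y \<le> hdist S L p l x + \<bar>p' - p\<bar> + hdist S L p' l y"
  using dist_le_hdist[OF assms, of x y p l] hdist_shift[of S L p l y p'] by simp

lemma sqrt_sum_le:
  assumes "\<bar>u\<bar> \<le> m" "\<bar>v\<bar> \<le> n" "m\<^sup>2 + n\<^sup>2 \<le> c\<^sup>2" "0 \<le> c"
  shows "sqrt (u\<^sup>2 + v\<^sup>2) \<le> (c::real)"
proof (rule real_le_lsqrt)
  have "u\<^sup>2 \<le> m\<^sup>2" "v\<^sup>2 \<le> n\<^sup>2"
    using assms(1,2) by (auto simp flip: abs_le_square_iff)
  then show "u\<^sup>2 + v\<^sup>2 \<le> c\<^sup>2" using assms(3) by simp
qed (use assms in auto)

text \<open>Rational bounds turn each comparison of \<open>b\<close> with \<open>sqrt 3 * b\<close>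
  into linear arithmetic.\<close>

lemma sqrt3_bounds: "1732/1000 \<le> sqrt 3" "sqrt 3 \<le> 17321/10000"
proof -
  show "1732/1000 \<le> sqrt 3" by (rule real_le_rsqrt) (simp add: power2_eq_square)
  show "sqrt 3 \<le> 17321/10000" by (rule real_le_lsqrt) (simp_all add: power2_eq_square)
qed

lemma sqrt3_mult_bounds:
  assumes "0 \<le> b"
  shows "1732/1000 * b \<le> sqrt 3 * b" "sqrt 3 * b \<le> 17321/10000 * b"
  using mult_right_mono[OF sqrt3_bounds(1) assms] mult_right_mono[OF sqrt3_bounds(2) assms] by auto

lemma sqrt3_sq: "(sqrt 3 * b)\<^sup>2 = 3 * b\<^sup>2"
  by (simp add: power_mult_distrib)

lemma sqrt3_sqrt3: "sqrt 3 * (sqrt 3 * b) = 3 * b"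
  by (simp flip: mult.assoc)

text \<open>A cell is a rectangle centered at \<open>(s0, l0)\<close> with half-lengths \<open>b\<close> in direction \<open>S\<close> and
  \<open>sqrt 3 * b\<close> in direction \<open>L\<close>. Neighbouring cells meet in \<^emph>\<open>holes\<close>, the midpoints
  \<open>(s0 \<plusminus> b, l0)\<close> and \<open>(s0, l0 \<plusminus> sqrt 3 * b)\<close> of the sides, and \<open>eV (\<plusminus>1)\<close>, \<open>eU (\<plusminus>1)\<close> are the points
  through which the tree of the cell is left in the direction of these holes. In all estimates the
  distance of an entry to its hole is counted on the side of the tree distance: a later edge between
  two entries for a common hole is then paid for in advance, so the estimates pass to the next
  level without loss.

  The constants solve the recursive inequalities of the joining step. The numbers that matter
  are \<open>9/4\<close> and \<open>81/4 = 49/4 + 8\<close>, because \<open>(9/4)\<^sup>2 + (81/4)\<^sup>2 \<le> 416 = (4 * sqrt 26)\<^sup>2\<close>.\<close>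

locale cell_tree =
  fixes b :: real and S L :: "'a::metric_space \<Rightarrow> real" and s0 l0 :: real
    and V :: "'a set" and E :: "('a \<times> 'a) set" and D :: "'a \<Rightarrow> 'a \<Rightarrow> real"
    and eU eV :: "real \<Rightarrow> 'a"
  assumes b_pos: "0 < b"
    and mtree: "mtree V E D"
    and box_S: "x \<in> V \<Longrightarrow> \<bar>S x - s0\<bar> \<le> b"
    and box_L: "x \<in> V \<Longrightarrow> \<bar>L x - l0\<bar> \<le> sqrt 3 * b"
    and eU_in: "s \<in> {-1, 1} \<Longrightarrow> eU s \<in> V"
    and eV_in: "s \<in> {-1, 1} \<Longrightarrow> eV s \<in> V"
    and UU: "s \<in> {-1, 1} \<Longrightarrow> D (eU s) (eU (- s)) + hdist S L s0 (l0 + s * (sqrt 3 * b)) (eU s)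
      + hdist S L s0 (l0 - s * (sqrt 3 * b)) (eU (- s)) \<le> 9/2 * (sqrt 3 * b)"
    and VV: "s \<in> {-1, 1} \<Longrightarrow> D (eV s) (eV (- s)) + hdist S L (s0 + s * b) l0 (eV s)
      + hdist S L (s0 - s * b) l0 (eV (- s)) \<le> 9/2 * b"
    and UV: "s \<in> {-1, 1} \<Longrightarrow> t \<in> {-1, 1} \<Longrightarrow>
      D (eU s) (eV t) + hdist S L s0 (l0 + s * (sqrt 3 * b)) (eU s)
      + hdist S L (s0 + t * b) l0 (eV t) \<le> 8 * b"
    and BU1: "x \<in> V \<Longrightarrow> s \<in> {-1, 1} \<Longrightarrow> D x (eU s) + hdist S L s0 (l0 + s * (sqrt 3 * b)) (eU s)
      \<le> 9/4 * \<bar>L x - (l0 + s * (sqrt 3 * b))\<bar> + 81/4 * \<bar>S x - s0\<bar>"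
    and BU2: "x \<in> V \<Longrightarrow> s \<in> {-1, 1} \<Longrightarrow> D x (eU s) + hdist S L s0 (l0 + s * (sqrt 3 * b)) (eU s)
      \<le> 123/10 * b"
    and BV1: "x \<in> V \<Longrightarrow> s \<in> {-1, 1} \<Longrightarrow> D x (eV s) + hdist S L (s0 + s * b) l0 (eV s)
      \<le> 9/4 * \<bar>S x - (s0 + s * b)\<bar> + 81/4 * \<bar>L x - l0\<bar>"
    and BV2: "x \<in> V \<Longrightarrow> s \<in> {-1, 1} \<Longrightarrow> D x (eV s) + hdist S L (s0 + s * b) l0 (eV s) \<le> 49/4 * b"
    and BV3: "x \<in> V \<Longrightarrow> s \<in> {-1, 1} \<Longrightarrow> D x (eV s) + hdist S L (s0 + s * b) l0 (eV s)
      \<le> 8 * b + 81/4 * \<bar>S x - s0\<bar>"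
    and I: "(\<forall>s\<in>{-1, 1}. \<bar>L (eV s) - l0\<bar> \<le> sqrt 3 * b / 3) \<or>
      eV 1 = eV (-1) \<and>
      (\<forall>x\<in>V. (L x - l0) * (L (eV 1) - l0) > 0 \<longrightarrow> D x (eV 1) \<le> 49/12 * (sqrt 3 * b))"

lemma sum_two_sqrt_le:
  assumes "x\<^sup>2 + y\<^sup>2 \<le> c\<^sup>2 / 2" "0 \<le> (c::real)"
  shows "x + y \<le> c"
proof -
  have "(x + y)\<^sup>2 \<le> 2 * (x\<^sup>2 + y\<^sup>2)" using sum_squares_bound[of x y] by (simp add: power2_sum)
  also have "\<dots> \<le> c\<^sup>2" using assms(1) by simp
  finally show ?thesis using assms(2) by (rule power2_le_imp_le)
qed

section \<open>Distances from points of a parent cell to the holes\<close>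

context
  fixes S L :: "'a::metric_space \<Rightarrow> real" and s0 l0 b q :: real
  assumes b: "0 \<le> b" and q: "q = sqrt 3 * b"
begin

lemma q2: "q\<^sup>2 = 3 * b\<^sup>2" by (simp add: q sqrt3_sq)

lemma q_bounds: "1732/1000 * b \<le> q" "q \<le> 17321/10000 * b"
  unfolding q using sqrt3_mult_bounds[OF b] by auto

lemma abs_sign_diff_le:
  assumes "s \<in> {-1, 1}" "\<bar>v\<bar> \<le> m"
  shows "\<bar>v - s * q\<bar> \<le> m + q"
proof -
  have "0 \<le> q" using b by (simp add: q)
  with assms show ?thesis by auto
qed

text \<open>The factor is \<open>sqrt 21\<close> rounded up, attained at a corner of the parent. The
  later factors arise likewise from \<open>sqrt 19\<close>, \<open>sqrt (49/3)\<close>,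
  \<open>sqrt (43/3)\<close> and \<open>sqrt 12\<close>.\<close>

lemma perp_hole_bound:
  assumes "\<bar>S e - s0\<bar> \<le> 3 * b" "\<bar>L e - l0\<bar> \<le> q" "s \<in> {-1, 1}"
  shows "hdist S L s0 (l0 + s * q) e \<le> 4583/1000 * b"
  unfolding hdist_def
proof (rule sqrt_sum_le[OF assms(1), of _ "2 * q"])
  show "\<bar>L e - (l0 + s * q)\<bar> \<le> 2 * q"
    using abs_sign_diff_le[OF assms(3,2)] by (simp add: algebra_simps)
qed (use b q2 in \<open>auto simp: power_mult_distrib power2_eq_square mult.commute mult.left_commute\<close>)

text \<open>Two separate bounds would give \<open>2 * sqrt 21 * b\<close>, which is too much. The
  squares of the two distances add up to at most \<open>30 * b\<^sup>2\<close>, so the sum is at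
  most \<open>sqrt 60 * b\<close>, that is \<open>sqrt 20 * q\<close>.\<close>

lemma perp_holes_sum_bound:
  assumes "\<bar>S e - s0\<bar> \<le> 3 * b" "\<bar>L e - l0\<bar> \<le> q"
  shows "hdist S L s0 (l0 + q) e + hdist S L s0 (l0 - q) e \<le> 9/2 * q"
proof -
  have 1: "(S e - s0)\<^sup>2 \<le> 9 * b\<^sup>2" "(L e - l0)\<^sup>2 \<le> q\<^sup>2"
    using assms power_mono[OF assms(1), of 2] power_mono[OF assms(2), of 2]
    by (auto simp: power_mult_distrib)
  have "hdist S L s0 (l0 + q) e + hdist S L s0 (l0 - q) e \<le> 775/100 * b"
  proof (rule sum_two_sqrt_le)
    have "(hdist S L s0 (l0 + q) e)\<^sup>2 + (hdist S L s0 (l0 - q) e)\<^sup>2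
        = 2 * (S e - s0)\<^sup>2 + 2 * (L e - l0)\<^sup>2 + 2 * q\<^sup>2"
      by (simp add: hdist_def) (simp add: power2_eq_square algebra_simps)
    also have "\<dots> \<le> 30 * b\<^sup>2" using 1 q2 by simp
    also have "\<dots> \<le> (775/100 * b)\<^sup>2 / 2"
      by (simp add: power_mult_distrib power2_eq_square)
    finally show "(hdist S L s0 (l0 + q) e)\<^sup>2 + (hdist S L s0 (l0 - q) e)\<^sup>2
        \<le> (775/100 * b)\<^sup>2 / 2" .
  qed (use b in auto)
  then show ?thesis using q_bounds b by linarith
qed

text \<open>The length \<open>4 * b\<close> is the distance from an outer wall of the parent to the
  opposite wall of its middle child.\<close>

lemma far_side_hole_bound:
  assumes "\<bar>S e - p\<bar> \<le> 4 * b" "\<bar>L e - l0\<bar> \<le> q"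
  shows "hdist S L p l0 e \<le> 4359/1000 * b"
  unfolding hdist_def
  by (rule sqrt_sum_le[OF assms])
    (use b q2 in \<open>auto simp: power_mult_distrib power2_eq_square mult.commute mult.left_commute\<close>)

lemma far_side_hole_bound_mid:
  assumes "\<bar>S e - p\<bar> \<le> 4 * b" "\<bar>L e - l0\<bar> \<le> q / 3"
  shows "hdist S L p l0 e \<le> 405/100 * b"
  unfolding hdist_def
  by (rule sqrt_sum_le[OF assms])
    (use b q2 in \<open>auto simp: power_mult_distrib power_divide power2_eq_square mult.commute mult.left_commute\<close>)

lemma perp_hole_bound_mid:
  assumes "\<bar>S e - s0\<bar> \<le> 3 * b" "\<bar>L e - l0\<bar> \<le> q / 3" "s \<in> {-1, 1}"
  shows "hdist S L s0 (l0 + s * q) e \<le> 379/100 * b"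
  unfolding hdist_def
proof (rule sqrt_sum_le[OF assms(1), of _ "4 * q / 3"])
  show "\<bar>L e - (l0 + s * q)\<bar> \<le> 4 * q / 3"
    using abs_sign_diff_le[OF assms(3,2)] by (simp add: algebra_simps)
qed (use b q2 in \<open>auto simp: power_mult_distrib power_divide power2_eq_square mult.commute mult.left_commute\<close>)

lemma perp_hole_bound_near:
  assumes "\<bar>S e - s0\<bar> \<le> 3 * b" "\<bar>L e - (l0 + s * q)\<bar> \<le> q"
  shows "hdist S L s0 (l0 + s * q) e \<le> 347/100 * b"
  unfolding hdist_def
  by (rule sqrt_sum_le[OF assms])
    (use b q2 in \<open>auto simp: power_mult_distrib power2_eq_square mult.commute mult.left_commute\<close>)

end

text \<open>The second root is convex in \<open>v1\<close>; its chord over \<open>0 \<le> v1 \<le> sqrt 3 b\<close> and a linear minorant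
  of the last root (Cauchy--Schwarz against its value at \<open>y = 2 b\<close>, \<open>v2 = sqrt 3 b\<close>) reduce the
  claim to a linear one.\<close>
lemma opposite_entries_bound:
  fixes b q y w v1 v2 :: real
  assumes b: "0 \<le> b" and q: "q = sqrt 3 * b"
    and y: "0 \<le> y" "y \<le> 2 * b" and w: "\<bar>w\<bar> \<le> 4 * b + y"
    and v: "0 \<le> v1" "v1 \<le> v2" "v2 \<le> q"
  shows "sqrt (w\<^sup>2 + (v2 - v1)\<^sup>2) + sqrt ((3 * b)\<^sup>2 + (q + v1)\<^sup>2) \<le> 8 * b + sqrt (y\<^sup>2 + v2\<^sup>2)"
proof -
  define d where "d = v2 - v1"
  have qb: "1732/1000 * b \<le> q" "q \<le> 17321/10000 * b" "q\<^sup>2 = 3 * b\<^sup>2"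
    using q_bounds[OF b q] q2[OF b q] by auto
  have 1: "sqrt ((3 * b)\<^sup>2 + (q + v1)\<^sup>2) \<le> 3465/1000 * b + 646/1000 * v1"
  proof (rule real_le_lsqrt)
    have "v1 * v1 \<le> 17321/10000 * b * v1" "q * v1 \<le> 17321/10000 * b * v1"
      using v qb by (intro mult_right_mono; simp)+
    moreover have "0 \<le> b * v1" "0 \<le> b * b" using b v by auto
    moreover have "(3465/1000 * b + 646/1000 * v1)\<^sup>2 - ((3 * b)\<^sup>2 + (q + v1)\<^sup>2)
        = 3006225/1000000 * (b * b) + 447678/100000 * (b * v1) - 582684/1000000 * (v1 * v1)
          - 2 * (q * v1) - q\<^sup>2"
      by (simp add: power2_eq_square field_simps)
    ultimately show "(3 * b)\<^sup>2 + (q + v1)\<^sup>2 \<le> (3465/1000 * b + 646/1000 * v1)\<^sup>2"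
      using qb(3) unfolding power2_eq_square[of b] by argo
  qed (use b v in auto)
  have 2: "755/1000 * y + 6546/10000 * v2 \<le> sqrt (y\<^sup>2 + v2\<^sup>2)"
  proof (rule real_le_rsqrt)
    have "0 \<le> (6546/10000 * y - 755/1000 * v2)\<^sup>2 + (1 - (755/1000)\<^sup>2 - (6546/10000)\<^sup>2) * (y\<^sup>2 + v2\<^sup>2)"
      by (intro add_nonneg_nonneg mult_nonneg_nonneg) (auto simp: power2_eq_square)
    also have "\<dots> = y\<^sup>2 + v2\<^sup>2 - (755/1000 * y + 6546/10000 * v2)\<^sup>2"
      by (simp add: power2_eq_square field_simps)
    finally show "(755/1000 * y + 6546/10000 * v2)\<^sup>2 \<le> y\<^sup>2 + v2\<^sup>2" by simp
  qed
  \<comment> \<open>As \<open>d\<close> is at most about \<open>sqrt 3 * b\<close>, its square is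
    dominated by the cross term \<open>12/5 * (b * d)\<close> that the slope \<open>3/10\<close>
    produces.\<close>
  have 3: "sqrt (w\<^sup>2 + d\<^sup>2) \<le> 4 * b + y + 3/10 * d"
  proof (rule real_le_lsqrt)
    have d: "0 \<le> d" "d \<le> 17321/10000 * b" using v qb by (auto simp: d_def)
    have "w\<^sup>2 \<le> (4 * b + y)\<^sup>2" using w by (auto simp flip: abs_le_square_iff)
    moreover have "d * d \<le> 17321/10000 * b * d" using d by (intro mult_right_mono; simp)
    moreover have "0 \<le> b * d" "0 \<le> y * d" "0 \<le> d * d" using b y d by auto
    moreover have "(4 * b + y + 3/10 * d)\<^sup>2
        = (4 * b + y)\<^sup>2 + 12/5 * (b * d) + 3/5 * (y * d) + 9/100 * (d * d)"
      by (simp add: power2_eq_square field_simps)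
    ultimately show "w\<^sup>2 + d\<^sup>2 \<le> (4 * b + y + 3/10 * d)\<^sup>2"
      unfolding power2_eq_square[of d] by argo
  qed (use b y v in \<open>auto simp: d_def\<close>)
  show ?thesis using 1 2 3 y v qb b unfolding d_def by argo
qed

text \<open>One point serves as all four entries. The tight requirement is \<open>VV\<close>: the
  squared distances to opposite holes add up to at most \<open>10 * b\<^sup>2\<close>, so their sum
  is at most \<open>sqrt 20 * b\<close>, and \<open>9/2\<close> is \<open>sqrt 20\<close> rounded
  up.\<close>

lemma cell_tree_single:
  fixes S L :: "'a::metric_space \<Rightarrow> real"
  assumes b: "0 < b" and boxS: "\<bar>S v - s0\<bar> \<le> b" and boxL: "\<bar>L v - l0\<bar> \<le> sqrt 3 * b"
  shows "cell_tree b S L s0 l0 {v} {} (\<lambda>_ _. 0) (\<lambda>_. v) (\<lambda>_. v)"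
proof -
  define q where "q = sqrt 3 * b"
  note b0 = less_imp_le[OF b]
  note qb = q_bounds[OF b0 q_def] and qq = q2[OF b0 q_def]
  have boxL': "\<bar>L v - l0\<bar> \<le> q" using boxL unfolding q_def .
  have sgn: "\<bar>z - (p + s * h)\<bar> \<le> 2 * h" if "\<bar>z - p\<bar> \<le> h" "s \<in> {-1, 1}" for z p h s :: real
    using that by auto
  have U: "hdist S L s0 (l0 + s * q) v \<le> 361/100 * b" if "s \<in> {-1, 1}" for s
    unfolding hdist_def
    by (rule sqrt_sum_le[OF boxS sgn[OF boxL' that]])
      (use b in \<open>auto simp: power_mult_distrib power_divide qq\<close>)
  have V: "hdist S L (s0 + s * b) l0 v \<le> 265/100 * b" if "s \<in> {-1, 1}" for s
    unfolding hdist_def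
    by (rule sqrt_sum_le[OF sgn[OF boxS that] boxL'])
      (use b in \<open>auto simp: power_mult_distrib power_divide qq\<close>)
  have l1: "hdist S L p l v \<le> \<bar>S v - p\<bar> + \<bar>L v - l\<bar>" for p l
    unfolding hdist_def by (rule sqrt_sum_squares_le_sum_abs)
  have VV: "hdist S L (s0 + b) l0 v + hdist S L (s0 - b) l0 v \<le> 9/2 * b"
  proof (rule sum_two_sqrt_le)
    have "(S v - s0)\<^sup>2 \<le> b\<^sup>2" "(L v - l0)\<^sup>2 \<le> q\<^sup>2"
      using power_mono[OF boxS, of 2] power_mono[OF boxL', of 2] by auto
    moreover have "(hdist S L (s0 + b) l0 v)\<^sup>2 + (hdist S L (s0 - b) l0 v)\<^sup>2
        = 2 * (S v - s0)\<^sup>2 + 2 * (L v - l0)\<^sup>2 + 2 * b\<^sup>2"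
      by (simp add: hdist_def) (simp add: power2_eq_square algebra_simps)
    moreover have "(9/2 * b)\<^sup>2 / 2 = 81/8 * b\<^sup>2" by (simp add: power_mult_distrib power_divide)
    ultimately show "(hdist S L (s0 + b) l0 v)\<^sup>2 + (hdist S L (s0 - b) l0 v)\<^sup>2 \<le> (9/2 * b)\<^sup>2 / 2"
      using qq zero_le_power2[of b] by linarith
  qed (use b in auto)
  have abs: "0 \<le> \<bar>z\<bar>" for z :: real by simp
  show ?thesis
  proof unfold_locales
    show "0 < b" by (rule b)
    show "mtree {v} {} (\<lambda>_ _. 0)" by (rule mtree.single)
    show "\<bar>S x - s0\<bar> \<le> b" "\<bar>L x - l0\<bar> \<le> sqrt 3 * b" if "x \<in> {v}" for x
      using that boxS boxL by auto
    fix s :: real assume s: "s \<in> {-1, 1}"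
    then have ms: "- s \<in> {-1, 1}" by auto
    show "v \<in> {v}" by simp
    show "0 + hdist S L s0 (l0 + s * (sqrt 3 * b)) v + hdist S L s0 (l0 - s * (sqrt 3 * b)) v
        \<le> 9/2 * (sqrt 3 * b)"
    proof -
      have "hdist S L s0 (l0 - s * q) v \<le> 361/100 * b" using U[OF ms] by simp
      then show ?thesis using U[OF s] qb b unfolding q_def[symmetric] by argo
    qed
    show "0 + hdist S L (s0 + s * b) l0 v + hdist S L (s0 - s * b) l0 v \<le> 9/2 * b"
      using VV s by auto
    show "0 + hdist S L s0 (l0 + s * (sqrt 3 * b)) v + hdist S L (s0 + t * b) l0 v \<le> 8 * b"
      if "t \<in> {-1, 1}" for t using U[OF s] V[OF that] b unfolding q_def by simp
    fix x assume "x \<in> {v}"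
    then have x: "x = v" by simp
    show "0 + hdist S L s0 (l0 + s * (sqrt 3 * b)) v
        \<le> 9/4 * \<bar>L x - (l0 + s * (sqrt 3 * b))\<bar> + 81/4 * \<bar>S x - s0\<bar>"
      using l1[of s0 "l0 + s * (sqrt 3 * b)"] abs[of "S v - s0"] abs[of "L v - (l0 + s * (sqrt 3 * b))"]
      unfolding x by argo
    show "0 + hdist S L s0 (l0 + s * (sqrt 3 * b)) v \<le> 123/10 * b"
      using U[OF s] b unfolding q_def by simp
    show "0 + hdist S L (s0 + s * b) l0 v \<le> 9/4 * \<bar>S x - (s0 + s * b)\<bar> + 81/4 * \<bar>L x - l0\<bar>"
      using l1[of "s0 + s * b" l0] abs[of "S v - (s0 + s * b)"] abs[of "L v - l0"] unfolding x by argo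
    show "0 + hdist S L (s0 + s * b) l0 v \<le> 49/4 * b" using V[OF s] b by simp
    show "0 + hdist S L (s0 + s * b) l0 v \<le> 8 * b + 81/4 * \<bar>S x - s0\<bar>"
      using V[OF s] b abs[of "S x - s0"] by argo
  next
    show "(\<forall>s\<in>{-1, 1}. \<bar>L v - l0\<bar> \<le> sqrt 3 * b / 3) \<or>
      v = v \<and> (\<forall>x\<in>{v}. (L x - l0) * (L v - l0) > 0 \<longrightarrow> 0 \<le> 49/12 * (sqrt 3 * b))"
      using b by simp
  qed
qed

section \<open>Joining three cells\<close>

text \<open>The locale for the parent, rewritten in the coordinates of its children:
  \<open>L\<close> becomes the short direction, and the long half-length \<open>sqrt 3 * q\<close>
  is \<open>3 * b\<close>. In \<open>I\<close>, the factor \<open>49/12\<close> of that length gives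
  \<open>49/4 * b\<close>, which is \<open>BV2\<close> of a child.\<close>

lemma cell_tree_parentI:
  fixes S L :: "'a::metric_space \<Rightarrow> real"
  assumes b: "0 < b" and q: "q = sqrt 3 * b"
    and "mtree V E D"
    and "\<And>x. x \<in> V \<Longrightarrow> \<bar>L x - l0\<bar> \<le> q"
    and "\<And>x. x \<in> V \<Longrightarrow> \<bar>S x - s0\<bar> \<le> 3 * b"
    and "\<And>s. s \<in> {-1, 1} \<Longrightarrow> eU s \<in> V"
    and "\<And>s. s \<in> {-1, 1} \<Longrightarrow> eV s \<in> V"
    and UU: "\<And>s. s \<in> {-1, 1} \<Longrightarrow> D (eU s) (eU (- s)) + hdist S L (s0 + 3 * s * b) l0 (eU s)
      + hdist S L (s0 - 3 * s * b) l0 (eU (- s)) \<le> 27/2 * b"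
    and VV: "\<And>s. s \<in> {-1, 1} \<Longrightarrow> D (eV s) (eV (- s)) + hdist S L s0 (l0 + s * q) (eV s)
      + hdist S L s0 (l0 - s * q) (eV (- s)) \<le> 9/2 * q"
    and UV: "\<And>s t. s \<in> {-1, 1} \<Longrightarrow> t \<in> {-1, 1} \<Longrightarrow>
      D (eU s) (eV t) + hdist S L (s0 + 3 * s * b) l0 (eU s) + hdist S L s0 (l0 + t * q) (eV t)
      \<le> 8 * q"
    and BU1: "\<And>x s. x \<in> V \<Longrightarrow> s \<in> {-1, 1} \<Longrightarrow> D x (eU s) + hdist S L (s0 + 3 * s * b) l0 (eU s)
      \<le> 9/4 * \<bar>S x - (s0 + 3 * s * b)\<bar> + 81/4 * \<bar>L x - l0\<bar>"
    and BU2: "\<And>x s. x \<in> V \<Longrightarrow> s \<in> {-1, 1} \<Longrightarrow> D x (eU s) + hdist S L (s0 + 3 * s * b) l0 (eU s)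
      \<le> 123/10 * q"
    and BV1: "\<And>x s. x \<in> V \<Longrightarrow> s \<in> {-1, 1} \<Longrightarrow> D x (eV s) + hdist S L s0 (l0 + s * q) (eV s)
      \<le> 9/4 * \<bar>L x - (l0 + s * q)\<bar> + 81/4 * \<bar>S x - s0\<bar>"
    and BV2: "\<And>x s. x \<in> V \<Longrightarrow> s \<in> {-1, 1} \<Longrightarrow> D x (eV s) + hdist S L s0 (l0 + s * q) (eV s)
      \<le> 49/4 * q"
    and BV3: "\<And>x s. x \<in> V \<Longrightarrow> s \<in> {-1, 1} \<Longrightarrow> D x (eV s) + hdist S L s0 (l0 + s * q) (eV s)
      \<le> 8 * q + 81/4 * \<bar>L x - l0\<bar>"
    and I: "(\<forall>s\<in>{-1, 1}. \<bar>S (eV s) - s0\<bar> \<le> b) \<or>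
      eV 1 = eV (-1) \<and>
      (\<forall>x\<in>V. (S x - s0) * (S (eV 1) - s0) > 0 \<longrightarrow> D x (eV 1) \<le> 49/4 * b)"
  shows "cell_tree q L S l0 s0 V E D eU eV"
proof -
  have qq: "sqrt 3 * q = 3 * b" using q sqrt3_sqrt3 by simp
  have "0 < q" using b q by simp
  have *: "s * (3 * b) = 3 * s * b" for s by simp
  show ?thesis
    unfolding cell_tree_def qq * hdist_commute[of L S]
    using assms \<open>0 < q\<close> by auto
qed

text \<open>The sign \<open>\<sigma>\<close> treats the left and the right child at once. The inner
  hole \<open>s0 + \<sigma> * b\<close> is shared with the middle child, the outer one
  \<open>s0 + 3 * \<sigma> * b\<close> is a hole of the parent.\<close>

lemma child_facts:
  assumes "cell_tree b S L (s0 + 2 * \<sigma> * b) l0 V E D eU eV" and "\<sigma> \<in> {-1, 1}"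
  shows child_VV: "D (eV \<sigma>) (eV (- \<sigma>)) + hdist S L (s0 + 3 * \<sigma> * b) l0 (eV \<sigma>)
      + hdist S L (s0 + \<sigma> * b) l0 (eV (- \<sigma>)) \<le> 9/2 * b"
    and child_box: "x \<in> V \<Longrightarrow> b \<le> \<bar>S x - s0\<bar>" "x \<in> V \<Longrightarrow> \<bar>S x - s0\<bar> \<le> 3 * b"
      "x \<in> V \<Longrightarrow> \<bar>S x - (s0 + \<sigma> * b)\<bar> = \<bar>S x - s0\<bar> - b"
      "x \<in> V \<Longrightarrow> \<bar>S x - (s0 - \<sigma> * b)\<bar> = \<bar>S x - s0\<bar> + b"
      "x \<in> V \<Longrightarrow> \<bar>S x - (s0 + 3 * \<sigma> * b)\<bar> = 3 * b - \<bar>S x - s0\<bar>"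
      "x \<in> V \<Longrightarrow> \<bar>S x - (s0 - 3 * \<sigma> * b)\<bar> = 3 * b + \<bar>S x - s0\<bar>"
      "x \<in> V \<Longrightarrow> \<sigma> * (S x - s0) = \<bar>S x - s0\<bar>"
    and child_in1: "x \<in> V \<Longrightarrow> D x (eV (- \<sigma>)) + hdist S L (s0 + \<sigma> * b) l0 (eV (- \<sigma>))
      \<le> 9/4 * (\<bar>S x - s0\<bar> - b) + 81/4 * \<bar>L x - l0\<bar>"
    and child_in2: "x \<in> V \<Longrightarrow> D x (eV (- \<sigma>)) + hdist S L (s0 + \<sigma> * b) l0 (eV (- \<sigma>)) \<le> 49/4 * b"
    and child_out1: "x \<in> V \<Longrightarrow> D x (eV \<sigma>) + hdist S L (s0 + 3 * \<sigma> * b) l0 (eV \<sigma>)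
      \<le> 9/4 * (3 * b - \<bar>S x - s0\<bar>) + 81/4 * \<bar>L x - l0\<bar>"
    and child_out2: "x \<in> V \<Longrightarrow> D x (eV \<sigma>) + hdist S L (s0 + 3 * \<sigma> * b) l0 (eV \<sigma>) \<le> 49/4 * b"
proof -
  interpret cell_tree b S L "s0 + 2 * \<sigma> * b" l0 V E D eU eV by fact
  have h: "s0 + 2 * \<sigma> * b + \<sigma> * b = s0 + 3 * \<sigma> * b" "s0 + 2 * \<sigma> * b - \<sigma> * b = s0 + \<sigma> * b"
    "s0 + 2 * \<sigma> * b + - \<sigma> * b = s0 + \<sigma> * b" by (auto simp: algebra_simps)
  have s: "- \<sigma> \<in> {-1, 1}" using assms(2) by auto
  show "D (eV \<sigma>) (eV (- \<sigma>)) + hdist S L (s0 + 3 * \<sigma> * b) l0 (eV \<sigma>)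
      + hdist S L (s0 + \<sigma> * b) l0 (eV (- \<sigma>)) \<le> 9/2 * b"
    using VV[OF assms(2)] unfolding h .
  assume x: "x \<in> V"
  show box: "b \<le> \<bar>S x - s0\<bar>" "\<bar>S x - s0\<bar> \<le> 3 * b"
      "\<bar>S x - (s0 + \<sigma> * b)\<bar> = \<bar>S x - s0\<bar> - b"
      "\<bar>S x - (s0 - \<sigma> * b)\<bar> = \<bar>S x - s0\<bar> + b"
      "\<bar>S x - (s0 + 3 * \<sigma> * b)\<bar> = 3 * b - \<bar>S x - s0\<bar>"
      "\<bar>S x - (s0 - 3 * \<sigma> * b)\<bar> = 3 * b + \<bar>S x - s0\<bar>"
      "\<sigma> * (S x - s0) = \<bar>S x - s0\<bar>"
    using box_S[OF x] b_pos assms(2) by auto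
  show "D x (eV (- \<sigma>)) + hdist S L (s0 + \<sigma> * b) l0 (eV (- \<sigma>)) \<le> 49/4 * b"
    "D x (eV \<sigma>) + hdist S L (s0 + 3 * \<sigma> * b) l0 (eV \<sigma>) \<le> 49/4 * b"
    "D x (eV (- \<sigma>)) + hdist S L (s0 + \<sigma> * b) l0 (eV (- \<sigma>))
      \<le> 9/4 * (\<bar>S x - s0\<bar> - b) + 81/4 * \<bar>L x - l0\<bar>"
    "D x (eV \<sigma>) + hdist S L (s0 + 3 * \<sigma> * b) l0 (eV \<sigma>)
      \<le> 9/4 * (3 * b - \<bar>S x - s0\<bar>) + 81/4 * \<bar>L x - l0\<bar>"
    using BV2[OF x s] BV2[OF x assms(2)] BV1[OF x s] BV1[OF x assms(2)] unfolding h box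
    by blast+
qed

text \<open>A bridge from \<open>m\<close> to the inner entry of the outer child; its outer entry
  becomes \<open>e\<close>. If the child is empty, \<open>m\<close> itself takes the role of
  \<open>e\<close>: the outer hole is \<open>2 * b\<close> beyond the inner one, within the
  \<open>9/2 * b\<close> allowed for crossing a child.\<close>

lemma attach_outer_child:
  assumes c: "plane_coords S L" and tree: "mtree V E D" and m: "m \<in> V" and disj: "V \<inter> W = {}"
    and \<sigma>: "\<sigma> \<in> {-1, 1}" and b: "0 < b"
    and W: "W = {} \<or> cell_tree b S L (s0 + 2 * \<sigma> * b) l0 W F G gU gV"
  obtains E' D' e where "mtree (V \<union> W) E' D'" "e \<in> V \<union> W"
    "\<And>x y. x \<in> V \<Longrightarrow> y \<in> V \<Longrightarrow> D' x y = D x y"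
    "\<And>x y. x \<in> W \<Longrightarrow> y \<in> W \<Longrightarrow> D' x y = G x y"
    "\<And>x y. x \<in> W \<Longrightarrow> y \<in> V \<Longrightarrow> D' x y \<le>
      G x (gV (- \<sigma>)) + hdist S L (s0 + \<sigma> * b) l0 (gV (- \<sigma>)) + hdist S L (s0 + \<sigma> * b) l0 m + D m y"
    "\<And>y. y \<in> V \<Longrightarrow> D' e y + hdist S L (s0 + 3 * \<sigma> * b) l0 e \<le>
      9/2 * b + hdist S L (s0 + \<sigma> * b) l0 m + D m y"
    "\<And>x. x \<in> W \<Longrightarrow> D' x e + hdist S L (s0 + 3 * \<sigma> * b) l0 e \<le>
      G x (gV \<sigma>) + hdist S L (s0 + 3 * \<sigma> * b) l0 (gV \<sigma>)"
proof (cases "W = {}")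
  case True
  have "\<bar>(s0 + \<sigma> * b) - (s0 + 3 * \<sigma> * b)\<bar> = 2 * b" using \<sigma> b by auto
  then have "hdist S L (s0 + 3 * \<sigma> * b) l0 m \<le> hdist S L (s0 + \<sigma> * b) l0 m + 2 * b"
    using hdist_shift[of S L "s0 + 3 * \<sigma> * b" l0 m "s0 + \<sigma> * b"] by simp
  then show ?thesis using that[of E D m] tree m b True by auto
next
  case False
  with W have N: "cell_tree b S L (s0 + 2 * \<sigma> * b) l0 W F G gU gV" by simp
  interpret N: cell_tree b S L "s0 + 2 * \<sigma> * b" l0 W F G gU gV by fact
  let ?e1 = "gV (- \<sigma>)"
  let ?D = "join_dist V D G m ?e1"
  have e1: "?e1 \<in> W" and e: "gV \<sigma> \<in> W" using N.eV_in \<sigma> by auto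
  have nV: "x \<notin> V" if "x \<in> W" for x using that disj by auto
  have g: "dist m ?e1 \<le> hdist S L (s0 + \<sigma> * b) l0 m + hdist S L (s0 + \<sigma> * b) l0 ?e1"
    by (rule dist_le_hdist[OF c])
  have vv: "G (gV \<sigma>) ?e1 + hdist S L (s0 + 3 * \<sigma> * b) l0 (gV \<sigma>)
      + hdist S L (s0 + \<sigma> * b) l0 ?e1 \<le> 9/2 * b" by (rule child_VV[OF N \<sigma>])
  show ?thesis
  proof (rule that[OF mtree.join[OF tree N.mtree disj m e1]])
    show "gV \<sigma> \<in> V \<union> W" using e by simp
  qed (use g vv nV e in \<open>auto simp: join_dist_def\<close>)
qed

lemma sign_cases [consumes 1, case_names neg pos]: "(s::real) \<in> {-1, 1} \<Longrightarrow> (s = -1 \<Longrightarrow> P) \<Longrightarrow> (s = 1 \<Longrightarrow> P) \<Longrightarrow> P"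
  by auto

text \<open>The holes of the middle child in direction \<open>L\<close> are also those of the
  parent. Hence \<open>mU\<close> becomes the new \<open>eV\<close>, and \<open>UU\<close> of the
  middle child is \<open>VV\<close> of the parent.\<close>

lemma cell_tree_join_middle:
  fixes S L :: "'a::metric_space \<Rightarrow> real"
  assumes c: "plane_coords S L" and b: "0 < b" and q: "q = sqrt 3 * b"
    and M: "cell_tree b S L s0 l0 VM EM DM mU mV"
    and Lc: "VL = {} \<or> cell_tree b S L (s0 + 2 * (-1) * b) l0 VL EL DL lU lV"
    and Rc: "VR = {} \<or> cell_tree b S L (s0 + 2 * 1 * b) l0 VR ER DR rU rV"
    and disj: "VL \<inter> VM = {}" "VL \<inter> VR = {}" "VM \<inter> VR = {}"
  shows "\<exists>E D eU eV. cell_tree q L S l0 s0 (VL \<union> VM \<union> VR) E D eU eV \<and>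
    (\<forall>x\<in>VL. \<forall>y\<in>VL. D x y = DL x y) \<and> (\<forall>x\<in>VM. \<forall>y\<in>VM. D x y = DM x y) \<and>
    (\<forall>x\<in>VR. \<forall>y\<in>VR. D x y = DR x y) \<and>
    (\<forall>x\<in>VL. \<forall>y\<in>VM. D x y \<le> DL x (lV 1) + hdist S L (s0 - b) l0 (lV 1)
       + (DM y (mV (-1)) + hdist S L (s0 - b) l0 (mV (-1)))) \<and>
    (\<forall>x\<in>VR. \<forall>y\<in>VM. D x y \<le> DR x (rV (-1)) + hdist S L (s0 + b) l0 (rV (-1))
       + (DM y (mV 1) + hdist S L (s0 + b) l0 (mV 1))) \<and>
    (\<forall>x\<in>VR. \<forall>y\<in>VL. D x y \<le> DR x (rV (-1)) + hdist S L (s0 + b) l0 (rV (-1)) + 9/2 * b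
       + (DL y (lV 1) + hdist S L (s0 - b) l0 (lV 1)))"
proof -
  interpret M: cell_tree b S L s0 l0 VM EM DM mU mV by fact
  let ?h = "\<lambda>p. hdist S L p l0" and ?t = "\<lambda>s. hdist S L s0 (l0 + s * q)"
  note qb = q_bounds[OF less_imp_le[OF b] q]
  have mV: "mV 1 \<in> VM" "mV (-1) \<in> VM" using M.eV_in by auto
  have s1: "(-1::real) \<in> {-1, 1}" "(1::real) \<in> {-1, 1}" by auto
  have disjL: "VM \<inter> VL = {}" using disj by auto
  obtain E1 D1 e1 where tree1: "mtree (VM \<union> VL) E1 D1" "e1 \<in> VM \<union> VL"
    and D1M: "\<And>x y. x \<in> VM \<Longrightarrow> y \<in> VM \<Longrightarrow> D1 x y = DM x y"
    and D1L: "\<And>x y. x \<in> VL \<Longrightarrow> y \<in> VL \<Longrightarrow> D1 x y = DL x y"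
    and LM: "\<And>x y. x \<in> VL \<Longrightarrow> y \<in> VM \<Longrightarrow>
      D1 x y \<le> DL x (lV 1) + ?h (s0 - b) (lV 1) + ?h (s0 - b) (mV (-1)) + DM (mV (-1)) y"
    and e1M: "\<And>y. y \<in> VM \<Longrightarrow>
      D1 e1 y + ?h (s0 - 3 * b) e1 \<le> 9/2 * b + ?h (s0 - b) (mV (-1)) + DM (mV (-1)) y"
    and e1L: "\<And>x. x \<in> VL \<Longrightarrow>
      D1 x e1 + ?h (s0 - 3 * b) e1 \<le> DL x (lV (-1)) + ?h (s0 - 3 * b) (lV (-1))"
    using attach_outer_child[OF c M.mtree mV(2) disjL s1(1) b Lc] by auto
  have disjR: "(VM \<union> VL) \<inter> VR = {}" and mV1: "mV 1 \<in> VM \<union> VL" using disj mV by auto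
  obtain E D e2 where tree: "mtree (VM \<union> VL \<union> VR) E D" "e2 \<in> VM \<union> VL \<union> VR"
    and DD1: "\<And>x y. x \<in> VM \<union> VL \<Longrightarrow> y \<in> VM \<union> VL \<Longrightarrow> D x y = D1 x y"
    and DR: "\<And>x y. x \<in> VR \<Longrightarrow> y \<in> VR \<Longrightarrow> D x y = DR x y"
    and RM: "\<And>x y. x \<in> VR \<Longrightarrow> y \<in> VM \<union> VL \<Longrightarrow>
      D x y \<le> DR x (rV (-1)) + ?h (s0 + b) (rV (-1)) + ?h (s0 + b) (mV 1) + D1 (mV 1) y"
    and e2M: "\<And>y. y \<in> VM \<union> VL \<Longrightarrow>
      D e2 y + ?h (s0 + 3 * b) e2 \<le> 9/2 * b + ?h (s0 + b) (mV 1) + D1 (mV 1) y"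
    and e2R: "\<And>x. x \<in> VR \<Longrightarrow>
      D x e2 + ?h (s0 + 3 * b) e2 \<le> DR x (rV 1) + ?h (s0 + 3 * b) (rV 1)"
    using attach_outer_child[OF c tree1(1) mV1 disjR s1(2) b Rc] by auto
  let ?V = "VM \<union> VL \<union> VR"
  have symD: "D x y = D y x" if "x \<in> ?V" "y \<in> ?V" for x y
    using mtree_dist_sym[OF tree(1)] that by blast
  have symM: "DM x y = DM y x" if "x \<in> VM" "y \<in> VM" for x y
    using mtree_dist_sym[OF M.mtree] that by blast
  have sym1: "D1 x y = D1 y x" if "x \<in> VM \<union> VL" "y \<in> VM \<union> VL" for x y
    using mtree_dist_sym[OF tree1(1)] that by blast
  have vv: "DM (mV 1) (mV (-1)) + ?h (s0 + b) (mV 1) + ?h (s0 - b) (mV (-1)) \<le> 9/2 * b"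
    using M.VV[of 1] by simp
  define eU where "eU s = (if s = 1 then e2 else e1)" for s :: real
  have eU: "eU 1 = e2" "eU (-1) = e1" by (auto simp: eU_def)
  have e1V: "e1 \<in> ?V" using tree1 by auto
  have boxL: "\<bar>L x - l0\<bar> \<le> q" if "x \<in> ?V" for x
    using that M.box_L Lc Rc unfolding q by (auto dest!: cell_tree.box_L)
  have boxS: "\<bar>S x - s0\<bar> \<le> 3 * b" if "x \<in> ?V" for x
  proof -
    have "\<bar>S x - s0\<bar> \<le> 3 * b" if "x \<in> VM" using M.box_S[OF that] b by simp
    moreover have "\<bar>S x - s0\<bar> \<le> 3 * b" if "x \<in> VL" using that Lc child_box(2) by blast
    moreover have "\<bar>S x - s0\<bar> \<le> 3 * b" if "x \<in> VR" using that Rc child_box(2) by blast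
    ultimately show ?thesis using that by blast
  qed
  have uu: "D e2 e1 + ?h (s0 + 3 * b) e2 + ?h (s0 - 3 * b) e1 \<le> 27/2 * b"
    using e2M[of e1] e1M[OF mV(1)] sym1[of e1 "mV 1"] symM[OF mV] tree1(2) mV vv by fastforce
  have uv: "D (eU s) (mU t) + ?h (s0 + 3 * s * b) (eU s) + ?t t (mU t) \<le> 8 * q"
    if s: "s \<in> {-1, 1}" and t: "t \<in> {-1, 1}" for s t
    using s
  proof (cases rule: sign_cases)
    case neg
    have "D e1 (mU t) = D1 e1 (mU t)" using DD1 tree1(2) M.eU_in[OF t] by blast
    then show ?thesis
      using e1M[OF M.eU_in[OF t]] M.UV[OF t s1(1), folded q] symM[OF mV(2) M.eU_in[OF t]] qb b
      unfolding neg eU by simp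
  next
    case pos
    have "D1 (mV 1) (mU t) = DM (mV 1) (mU t)" using D1M mV M.eU_in[OF t] by blast
    then show ?thesis
      using e2M[of "mU t"] M.UV[OF t s1(2), folded q] symM[OF mV(1) M.eU_in[OF t]] M.eU_in[OF t] qb b
      unfolding pos eU by simp
  qed
  have bu_M: "D x (eU s) + ?h (s0 + 3 * s * b) (eU s) \<le> 9/2 * b + (DM x (mV s) + ?h (s0 + s * b) (mV s))"
    if x: "x \<in> VM" and s: "s \<in> {-1, 1}" for x s
    using s
  proof (cases rule: sign_cases)
    case neg
    have "D x e1 = D1 e1 x" using DD1[of x e1] sym1[of x e1] tree1(2) x by auto
    then show ?thesis using e1M[OF x] symM[OF x mV(2)] unfolding neg eU by simp
  next
    case pos
    have "D x e2 = D e2 x" using symD tree(2) x by blast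
    moreover have "D1 (mV 1) x = DM (mV 1) x" using D1M mV x by blast
    ultimately show ?thesis using e2M[of x] symM[OF x mV(1)] x unfolding pos eU by simp
  qed
  have bu_L1: "D x e1 + ?h (s0 - 3 * b) e1 \<le> DL x (lV (-1)) + ?h (s0 - 3 * b) (lV (-1))"
    if "x \<in> VL" for x using e1L[OF that] DD1[of x e1] that tree1(2) by auto
  have D1mV: "D1 (mV 1) x \<le> DL x (lV 1) + ?h (s0 - b) (lV 1) + ?h (s0 - b) (mV (-1)) + DM (mV (-1)) (mV 1)"
    if "x \<in> VL" for x using LM[OF that mV(1)] sym1[of x "mV 1"] that mV by auto
  \<comment> \<open>Two crossings at \<open>9/2 * b\<close> each. With \<open>49/4 * b\<close> for
    reaching the inner hole the total is \<open>85/4 * b\<close>, and \<open>123/10\<close> slightly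
    exceeds \<open>85/4\<close> divided by \<open>sqrt 3\<close>.\<close>
  have bu_L2: "D x e2 + ?h (s0 + 3 * b) e2 \<le> 9 * b + (DL x (lV 1) + ?h (s0 - b) (lV 1))"
    if "x \<in> VL" for x using e2M[of x] D1mV[OF that] symD[of x e2] that tree(2) vv symM[OF mV] by auto
  have bu_R1: "D x e1 + ?h (s0 - 3 * b) e1 \<le> 9 * b + (DR x (rV (-1)) + ?h (s0 + b) (rV (-1)))"
    if "x \<in> VR" for x
    using RM[OF that tree1(2)] e1M[OF mV(1)] sym1[of e1 "mV 1"] tree1(2) mV vv symM[OF mV] by auto
  \<comment> \<open>At most \<open>49/4 * b\<close> to reach the middle child and
    \<open>8 * b\<close> to turn there. Points of an outer child have distance at least
    \<open>b\<close> from the line \<open>s0\<close>, so the slope \<open>81/4 = 49/4 + 8\<close>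
    pays for both.\<close>
  have bv_L: "D x (mU t) + ?t t (mU t) \<le> 8 * b + (DL x (lV 1) + ?h (s0 - b) (lV 1))"
    if "x \<in> VL" "t \<in> {-1, 1}" for x t
    using LM[OF that(1) M.eU_in[OF that(2)]] DD1[of x "mU t"] that M.eU_in[OF that(2)]
      M.UV[OF that(2), of "-1"] symM[OF mV(2) M.eU_in[OF that(2)]] unfolding q by auto
  have bv_R: "D x (mU t) + ?t t (mU t) \<le> 8 * b + (DR x (rV (-1)) + ?h (s0 + b) (rV (-1)))"
    if "x \<in> VR" "t \<in> {-1, 1}" for x t
    using RM[OF that(1), of "mU t"] D1M[of "mV 1" "mU t"] that M.eU_in[OF that(2)] mV
      M.UV[OF that(2), of 1] symM[OF mV(1) M.eU_in[OF that(2)]] unfolding q by auto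
  have bv_M: "D x (mU t) = DM x (mU t)" if "x \<in> VM" "t \<in> {-1, 1}" for x t
    using DD1[of x "mU t"] D1M[of x "mU t"] that M.eU_in[OF that(2)] by simp
  have Lbox: "b \<le> \<bar>S x - s0\<bar>" "\<bar>S x - s0\<bar> \<le> 3 * b" "\<bar>S x - (s0 - 3 * b)\<bar> = 3 * b - \<bar>S x - s0\<bar>"
      "\<bar>S x - (s0 + 3 * b)\<bar> = 3 * b + \<bar>S x - s0\<bar>"
    and L_in: "DL x (lV 1) + ?h (s0 - b) (lV 1) \<le> 9/4 * (\<bar>S x - s0\<bar> - b) + 81/4 * \<bar>L x - l0\<bar>"
      "DL x (lV 1) + ?h (s0 - b) (lV 1) \<le> 49/4 * b"
    and L_out: "DL x (lV (-1)) + ?h (s0 - 3 * b) (lV (-1)) \<le> 9/4 * (3 * b - \<bar>S x - s0\<bar>) + 81/4 * \<bar>L x - l0\<bar>"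
      "DL x (lV (-1)) + ?h (s0 - 3 * b) (lV (-1)) \<le> 49/4 * b"
    if x: "x \<in> VL" for x
  proof -
    have ch: "cell_tree b S L (s0 + 2 * (-1) * b) l0 VL EL DL lU lV" using Lc x by auto
    show "b \<le> \<bar>S x - s0\<bar>" "\<bar>S x - s0\<bar> \<le> 3 * b" "\<bar>S x - (s0 - 3 * b)\<bar> = 3 * b - \<bar>S x - s0\<bar>"
      "\<bar>S x - (s0 + 3 * b)\<bar> = 3 * b + \<bar>S x - s0\<bar>"
      using child_box[OF ch _ x] by auto
    show "DL x (lV 1) + ?h (s0 - b) (lV 1) \<le> 9/4 * (\<bar>S x - s0\<bar> - b) + 81/4 * \<bar>L x - l0\<bar>"
      "DL x (lV 1) + ?h (s0 - b) (lV 1) \<le> 49/4 * b"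
      using child_in1[OF ch _ x] child_in2[OF ch _ x] by auto
    show "DL x (lV (-1)) + ?h (s0 - 3 * b) (lV (-1)) \<le> 9/4 * (3 * b - \<bar>S x - s0\<bar>) + 81/4 * \<bar>L x - l0\<bar>"
      "DL x (lV (-1)) + ?h (s0 - 3 * b) (lV (-1)) \<le> 49/4 * b"
      using child_out1[OF ch _ x] child_out2[OF ch _ x] by auto
  qed
  have Rbox: "b \<le> \<bar>S x - s0\<bar>" "\<bar>S x - s0\<bar> \<le> 3 * b" "\<bar>S x - (s0 + 3 * b)\<bar> = 3 * b - \<bar>S x - s0\<bar>"
      "\<bar>S x - (s0 - 3 * b)\<bar> = 3 * b + \<bar>S x - s0\<bar>"
    and R_in: "DR x (rV (-1)) + ?h (s0 + b) (rV (-1)) \<le> 9/4 * (\<bar>S x - s0\<bar> - b) + 81/4 * \<bar>L x - l0\<bar>"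
      "DR x (rV (-1)) + ?h (s0 + b) (rV (-1)) \<le> 49/4 * b"
    and R_out: "DR x (rV 1) + ?h (s0 + 3 * b) (rV 1) \<le> 9/4 * (3 * b - \<bar>S x - s0\<bar>) + 81/4 * \<bar>L x - l0\<bar>"
      "DR x (rV 1) + ?h (s0 + 3 * b) (rV 1) \<le> 49/4 * b"
    if x: "x \<in> VR" for x
  proof -
    have ch: "cell_tree b S L (s0 + 2 * 1 * b) l0 VR ER DR rU rV" using Rc x by auto
    show "b \<le> \<bar>S x - s0\<bar>" "\<bar>S x - s0\<bar> \<le> 3 * b" "\<bar>S x - (s0 + 3 * b)\<bar> = 3 * b - \<bar>S x - s0\<bar>"
      "\<bar>S x - (s0 - 3 * b)\<bar> = 3 * b + \<bar>S x - s0\<bar>"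
      using child_box[OF ch _ x] by auto
    show "DR x (rV (-1)) + ?h (s0 + b) (rV (-1)) \<le> 9/4 * (\<bar>S x - s0\<bar> - b) + 81/4 * \<bar>L x - l0\<bar>"
      "DR x (rV (-1)) + ?h (s0 + b) (rV (-1)) \<le> 49/4 * b"
      using child_in1[OF ch _ x] child_in2[OF ch _ x] by auto
    show "DR x (rV 1) + ?h (s0 + 3 * b) (rV 1) \<le> 9/4 * (3 * b - \<bar>S x - s0\<bar>) + 81/4 * \<bar>L x - l0\<bar>"
      "DR x (rV 1) + ?h (s0 + 3 * b) (rV 1) \<le> 49/4 * b"
      using child_out1[OF ch _ x] child_out2[OF ch _ x] by auto
  qed
  have nrm: "s0 + 3 * - 1 * b = s0 - 3 * b" "s0 + 3 * 1 * b = s0 + 3 * b" by auto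
  have "cell_tree q L S l0 s0 ?V E D eU mU"
  proof (rule cell_tree_parentI[OF b q tree(1) boxL boxS])
    fix s :: real assume s: "s \<in> {-1, 1}"
    show "eU s \<in> ?V" using s tree(2) e1V by (auto simp: eU_def)
    show "mU s \<in> ?V" using M.eU_in[OF s] by simp
    show "D (eU s) (eU (- s)) + ?h (s0 + 3 * s * b) (eU s) + ?h (s0 - 3 * s * b) (eU (- s)) \<le> 27/2 * b"
      using s uu symD[OF e1V tree(2)] by (auto simp: eU)
    show "D (mU s) (mU (- s)) + ?t s (mU s) + hdist S L s0 (l0 - s * q) (mU (- s)) \<le> 9/2 * q"
      using M.UU[OF s] bv_M[of "mU s" "-s"] M.eU_in[OF s] s unfolding q by auto
    fix t :: real assume t: "t \<in> {-1, 1}"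
    show "D (eU s) (mU t) + ?h (s0 + 3 * s * b) (eU s) + ?t t (mU t) \<le> 8 * q" by (rule uv[OF s t])
  next
    fix x s assume "x \<in> ?V" and s: "(s::real) \<in> {-1, 1}"
    then consider "x \<in> VM" | "x \<in> VL" | "x \<in> VR" by auto
    then have "D x (eU s) + ?h (s0 + 3 * s * b) (eU s)
          \<le> 9/4 * \<bar>S x - (s0 + 3 * s * b)\<bar> + 81/4 * \<bar>L x - l0\<bar> \<and>
        D x (eU s) + ?h (s0 + 3 * s * b) (eU s) \<le> 123/10 * q \<and>
        D x (mU s) + ?t s (mU s) \<le> 9/4 * \<bar>L x - (l0 + s * q)\<bar> + 81/4 * \<bar>S x - s0\<bar> \<and>
        D x (mU s) + ?t s (mU s) \<le> 49/4 * q \<and>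
        D x (mU s) + ?t s (mU s) \<le> 8 * q + 81/4 * \<bar>L x - l0\<bar>"
    proof cases
      case 1
      \<comment> \<open>At rate \<open>9/4\<close> these additional \<open>2 * b\<close> pay for
        crossing the outer child.\<close>
      have "\<bar>S x - (s0 + 3 * s * b)\<bar> = \<bar>S x - (s0 + s * b)\<bar> + 2 * b"
        using M.box_S[OF 1] b s by auto
      then show ?thesis
        using bu_M[OF 1 s] M.BV1[OF 1 s] M.BV2[OF 1 s] M.BU1[OF 1 s] M.BU2[OF 1 s] bv_M[OF 1 s] qb b
          abs_ge_zero[of "L x - l0"]
        unfolding q[symmetric] by (intro conjI; argo)
    next
      case 2
      show ?thesis
        using s
      proof (cases rule: sign_cases)
        case neg
        show ?thesis unfolding neg eU nrm
          using bu_L1[OF 2] bv_L[OF 2 s1(1)] Lbox[OF 2] L_in[OF 2] L_out[OF 2] qb b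
            abs_ge_zero[of "L x - l0"] abs_ge_zero[of "L x - (l0 + s * q)", unfolded neg]
          by (intro conjI; argo)
      next
        case pos
        show ?thesis unfolding pos eU nrm
          using bu_L2[OF 2] bv_L[OF 2 s1(2)] Lbox[OF 2] L_in[OF 2] L_out[OF 2] qb b
            abs_ge_zero[of "L x - l0"] abs_ge_zero[of "L x - (l0 + s * q)", unfolded pos]
          by (intro conjI; argo)
      qed
    next
      case 3
      show ?thesis
        using s
      proof (cases rule: sign_cases)
        case neg
        show ?thesis unfolding neg eU nrm
          using bu_R1[OF 3] bv_R[OF 3 s1(1)] Rbox[OF 3] R_in[OF 3] R_out[OF 3] qb b
            abs_ge_zero[of "L x - l0"] abs_ge_zero[of "L x - (l0 + s * q)", unfolded neg]
          by (intro conjI; argo)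
      next
        case pos
        show ?thesis unfolding pos eU nrm
          using e2R[OF 3] bv_R[OF 3 s1(2)] Rbox[OF 3] R_in[OF 3] R_out[OF 3] qb b
            abs_ge_zero[of "L x - l0"] abs_ge_zero[of "L x - (l0 + s * q)", unfolded pos]
          by (intro conjI; argo)
      qed
    qed
    then show "D x (eU s) + ?h (s0 + 3 * s * b) (eU s)
          \<le> 9/4 * \<bar>S x - (s0 + 3 * s * b)\<bar> + 81/4 * \<bar>L x - l0\<bar>"
        "D x (eU s) + ?h (s0 + 3 * s * b) (eU s) \<le> 123/10 * q"
        "D x (mU s) + ?t s (mU s) \<le> 9/4 * \<bar>L x - (l0 + s * q)\<bar> + 81/4 * \<bar>S x - s0\<bar>"
        "D x (mU s) + ?t s (mU s) \<le> 49/4 * q"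
        "D x (mU s) + ?t s (mU s) \<le> 8 * q + 81/4 * \<bar>L x - l0\<bar>" by auto
  next
    \<comment> \<open>The first alternative: both entries lie in the middle child, which is the
      middle third of the parent.\<close>
    show "(\<forall>s\<in>{-1, 1}. \<bar>S (mU s) - s0\<bar> \<le> b) \<or> mU 1 = mU (-1) \<and>
      (\<forall>x\<in>?V. (S x - s0) * (S (mU 1) - s0) > 0 \<longrightarrow> D x (mU 1) \<le> 49/4 * b)"
      using M.box_S M.eU_in by blast
  qed
  moreover have "?V = VL \<union> VM \<union> VR" by auto
  moreover have "D x y \<le> DR x (rV (-1)) + hdist S L (s0 + b) l0 (rV (-1)) + 9/2 * b
       + (DL y (lV 1) + hdist S L (s0 - b) l0 (lV 1))" if "x \<in> VR" "y \<in> VL" for x y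
    using RM[of x y] D1mV[of y] that vv symM[OF mV] by auto
  moreover have "D x y \<le> DL x (lV 1) + hdist S L (s0 - b) l0 (lV 1)
       + (DM y (mV (-1)) + hdist S L (s0 - b) l0 (mV (-1)))" if "x \<in> VL" "y \<in> VM" for x y
    using LM[of x y] DD1[of x y] that symM[OF mV(2), of y] by auto
  moreover have "D x y \<le> DR x (rV (-1)) + hdist S L (s0 + b) l0 (rV (-1))
       + (DM y (mV 1) + hdist S L (s0 + b) l0 (mV 1))" if "x \<in> VR" "y \<in> VM" for x y
    using RM[of x y] D1M[of "mV 1" y] that symM[OF mV(1), of y] mV by auto
  ultimately show ?thesis using DR DD1 D1M D1L by (intro exI[of _ E] exI[of _ D] exI[of _ eU] exI[of _ mU]) auto
qed

section \<open>Parents whose middle child is empty\<close>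

lemma hdist_perp_hole:
  assumes b: "0 < b" and q: "q = sqrt 3 * b" and "\<sigma> \<in> {-1, 1}" "s \<in> {-1, 1}"
  shows "hdist S L s0 (l0 + s * q) e \<le> hdist S L (s0 + \<sigma> * b) l0 e + 2 * b"
proof -
  \<comment> \<open>The legs \<open>b\<close> and \<open>sqrt 3 * b\<close> give a hypotenuse of
    exactly \<open>2 * b\<close>.\<close>
  have "(\<sigma> * b)\<^sup>2 = b\<^sup>2" "(s * q)\<^sup>2 = 3 * b\<^sup>2" using assms(3,4) by (auto simp: q sqrt3_sq)
  then have "(s0 + \<sigma> * b - s0)\<^sup>2 + (l0 - (l0 + s * q))\<^sup>2 = (2 * b)\<^sup>2"
    by (simp add: power_mult_distrib)
  then have "sqrt ((s0 + \<sigma> * b - s0)\<^sup>2 + (l0 - (l0 + s * q))\<^sup>2) = 2 * b"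
    using b by (metis real_sqrt_unique less_imp_le mult_pos_pos zero_less_numeral)
  then show ?thesis
    using hdist_triangle[of S L s0 "l0 + s * q" e "s0 + \<sigma> * b" l0] by simp
qed

text \<open>The inner entry of the only child serves the three holes away from it. The far hole is
  \<open>4 * b\<close> beyond the inner one, whereas \<open>27/2 - 9/2 = 9\<close> times
  \<open>b\<close> would be allowed for the two missing cells.\<close>

lemma cell_tree_outer_only:
  fixes S L :: "'a::metric_space \<Rightarrow> real"
  assumes b: "0 < b" and q: "q = sqrt 3 * b" and \<sigma>: "\<sigma> \<in> {-1, 1}"
    and N: "cell_tree b S L (s0 + 2 * \<sigma> * b) l0 V E D gU gV"
  shows "cell_tree q L S l0 s0 V E D gV (\<lambda>_. gV (- \<sigma>))"
proof -
  interpret N: cell_tree b S L "s0 + 2 * \<sigma> * b" l0 V E D gU gV by fact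
  let ?h = "\<lambda>p. hdist S L p l0" and ?t = "\<lambda>s. hdist S L s0 (l0 + s * q)"
  let ?e = "gV (- \<sigma>)" and ?f = "gV \<sigma>"
  note qb = q_bounds[OF less_imp_le[OF b] q]
  have m\<sigma>: "- \<sigma> \<in> {-1, 1}" using \<sigma> by auto
  have e: "?e \<in> V" and f: "?f \<in> V" using N.eV_in \<sigma> m\<sigma> by auto
  have sym: "D x y = D y x" if "x \<in> V" "y \<in> V" for x y
    using mtree_dist_sym[OF N.mtree] that by blast
  have ee: "D ?e ?e = 0" using mtree_dist_self[OF N.mtree] e by blast
  have vv: "D ?f ?e + ?h (s0 + 3 * \<sigma> * b) ?f + ?h (s0 + \<sigma> * b) ?e \<le> 9/2 * b"
    by (rule child_VV[OF N \<sigma>])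
  have "\<bar>(s0 + \<sigma> * b) - (s0 - 3 * \<sigma> * b)\<bar> = 4 * b" using \<sigma> b by auto
  then have out: "?h (s0 - 3 * \<sigma> * b) ?e \<le> ?h (s0 + \<sigma> * b) ?e + 4 * b"
    using hdist_shift[of S L "s0 - 3 * \<sigma> * b" l0 ?e "s0 + \<sigma> * b"] by simp
  have t: "?t s ?e \<le> ?h (s0 + \<sigma> * b) ?e + 2 * b" if "s \<in> {-1, 1}" for s
    by (rule hdist_perp_hole[OF b q \<sigma> that])
  have boxS: "\<bar>S x - s0\<bar> \<le> 3 * b" if "x \<in> V" for x using child_box(2)[OF N \<sigma> that] .
  have boxL: "\<bar>L x - l0\<bar> \<le> q" if "x \<in> V" for x using N.box_L[OF that] unfolding q .
  have t2: "?t s ?e \<le> 4583/1000 * b" if "s \<in> {-1, 1}" for s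
    by (rule perp_hole_bound[where S = S and L = L, OF less_imp_le[OF b] q boxS[OF e] boxL[OF e] that])
  have "?h (s0 + \<sigma> * b) ?e \<le> 4359/1000 * b"
    using far_side_hole_bound[where S = S and L = L and e = ?e and p = "s0 + \<sigma> * b" and ?l0.0 = l0,
        OF less_imp_le[OF b] q]
      child_box(3)[OF N \<sigma> e] boxS[OF e] boxL[OF e] b by simp
  then have out2: "?h (s0 - 3 * \<sigma> * b) ?e \<le> 8359/1000 * b" using out by simp
  have hn: "0 \<le> ?h p x" for p x by (rule hdist_nonneg)
  have two: "s = \<sigma> \<or> s = - \<sigma>" if "s \<in> {-1, 1}" for s using that \<sigma> by auto
  show ?thesis
  proof (rule cell_tree_parentI[OF b q N.mtree boxL boxS])
    fix s :: real assume s: "s \<in> {-1, 1}"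
    show "gV s \<in> V" using N.eV_in[OF s] .
    show "?e \<in> V" by (rule e)
    show "D (gV s) (gV (- s)) + ?h (s0 + 3 * s * b) (gV s) + ?h (s0 - 3 * s * b) (gV (- s)) \<le> 27/2 * b"
      using two[OF s] vv out b sym[OF e f] by auto
    show "D ?e ?e + ?t s ?e + hdist S L s0 (l0 - s * q) ?e \<le> 9/2 * q"
      using perp_holes_sum_bound[where S = S and L = L, OF less_imp_le[OF b] q boxS[OF e] boxL[OF e]] ee s by auto
    fix t' :: real assume t': "t' \<in> {-1, 1}"
    show "D (gV s) ?e + ?h (s0 + 3 * s * b) (gV s) + ?t t' ?e \<le> 8 * q"
      using two[OF s]
    proof
      assume "s = \<sigma>"
      then show ?thesis using vv t[OF t'] qb b hn[of "s0 + \<sigma> * b" ?e] by simp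
    next
      assume "s = - \<sigma>"
      then show ?thesis using ee out2 t2[OF t'] qb b by simp
    qed
  next
    fix x s assume x: "x \<in> V" and s: "(s::real) \<in> {-1, 1}"
    note box = child_box[OF N \<sigma> x] and inn = child_in1[OF N \<sigma> x] child_in2[OF N \<sigma> x]
      and outt = child_out1[OF N \<sigma> x] child_out2[OF N \<sigma> x]
    have "D x (gV s) + ?h (s0 + 3 * s * b) (gV s)
          \<le> 9/4 * \<bar>S x - (s0 + 3 * s * b)\<bar> + 81/4 * \<bar>L x - l0\<bar> \<and>
        D x (gV s) + ?h (s0 + 3 * s * b) (gV s) \<le> 123/10 * q"
      using two[OF s]
    proof
      assume "s = \<sigma>"
      then show ?thesis using outt box qb b by (intro conjI; simp only:; argo)
    next
      assume "s = - \<sigma>"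
      moreover have "s0 + 3 * - \<sigma> * b = s0 - 3 * \<sigma> * b" by simp
      ultimately show ?thesis using inn box qb b out by (intro conjI; simp only:; argo)
    qed
    then show "D x (gV s) + ?h (s0 + 3 * s * b) (gV s)
          \<le> 9/4 * \<bar>S x - (s0 + 3 * s * b)\<bar> + 81/4 * \<bar>L x - l0\<bar>"
        "D x (gV s) + ?h (s0 + 3 * s * b) (gV s) \<le> 123/10 * q" by auto
    show "D x ?e + ?t s ?e \<le> 9/4 * \<bar>L x - (l0 + s * q)\<bar> + 81/4 * \<bar>S x - s0\<bar>"
        "D x ?e + ?t s ?e \<le> 49/4 * q"
        "D x ?e + ?t s ?e \<le> 8 * q + 81/4 * \<bar>L x - l0\<bar>"
      using inn box t[OF s] qb b abs_ge_zero[of "L x - (l0 + s * q)"] by argo+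
  next
    show "(\<forall>s\<in>{-1, 1}. \<bar>S ?e - s0\<bar> \<le> b) \<or> ?e = ?e \<and>
      (\<forall>x\<in>V. (S x - s0) * (S ?e - s0) > 0 \<longrightarrow> D x ?e \<le> 49/4 * b)"
      using child_in2[OF N \<sigma>] hn[of "s0 + \<sigma> * b" ?e] by fastforce
  qed
qed

text \<open>One bridge links the inner entries, and the one nearer to the axis \<open>l0\<close>
  becomes the entry for both holes in direction \<open>L\<close>. A point of \<open>VB\<close> then
  pays up to \<open>49/4 + sqrt 19 + sqrt 21\<close> times \<open>b\<close> there. This recursion
  determines \<open>49/4\<close>: the total, rounded up, is just below
  \<open>49/4 * q\<close>.\<close>

lemma cell_tree_outer_pair:
  fixes S L :: "'a::metric_space \<Rightarrow> real"
  assumes c: "plane_coords S L" and b: "0 < b" and q: "q = sqrt 3 * b" and \<sigma>: "\<sigma> \<in> {-1, 1}"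
    and A: "cell_tree b S L (s0 + 2 * \<sigma> * b) l0 VA EA DA aU aV"
    and B: "cell_tree b S L (s0 + 2 * (- \<sigma>) * b) l0 VB EB DB bU bV"
    and disj: "VA \<inter> VB = {}"
    and closer: "\<bar>L (aV (- \<sigma>)) - l0\<bar> \<le> \<bar>L (bV \<sigma>) - l0\<bar>"
  defines "D \<equiv> join_dist VA DA DB (aV (- \<sigma>)) (bV \<sigma>)"
  shows "cell_tree q L S l0 s0 (VA \<union> VB) (EA \<union> EB \<union> {(aV (- \<sigma>), bV \<sigma>), (bV \<sigma>, aV (- \<sigma>))}) D
      (\<lambda>s. if s = \<sigma> then aV s else bV s) (\<lambda>_. aV (- \<sigma>))" (is ?cell)
    and "\<forall>x\<in>VA. \<forall>y\<in>VA. D x y = DA x y" and "\<forall>x\<in>VB. \<forall>y\<in>VB. D x y = DB x y"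
    and "\<forall>x\<in>VA. \<forall>y\<in>VB. D x y \<le> DA x (aV (- \<sigma>)) + hdist S L (s0 + \<sigma> * b) l0 (aV (- \<sigma>)) + 2 * b
      + (DB y (bV \<sigma>) + hdist S L (s0 - \<sigma> * b) l0 (bV \<sigma>))"
proof -
  interpret A: cell_tree b S L "s0 + 2 * \<sigma> * b" l0 VA EA DA aU aV by fact
  interpret B: cell_tree b S L "s0 + 2 * (- \<sigma>) * b" l0 VB EB DB bU bV by fact
  let ?h = "\<lambda>p. hdist S L p l0" and ?t = "\<lambda>s. hdist S L s0 (l0 + s * q)"
  let ?e1 = "aV (- \<sigma>)" and ?e2 = "bV \<sigma>" and ?f1 = "aV \<sigma>" and ?f2 = "bV (- \<sigma>)"
  let ?V = "VA \<union> VB" and ?E = "EA \<union> EB \<union> {(aV (- \<sigma>), bV \<sigma>), (bV \<sigma>, aV (- \<sigma>))}"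
  note b0 = less_imp_le[OF b]
  note qb = q_bounds[OF b0 q]
  have m\<sigma>: "- \<sigma> \<in> {-1, 1}" using \<sigma> by auto
  have e1: "?e1 \<in> VA" and f1: "?f1 \<in> VA" and e2: "?e2 \<in> VB" and f2: "?f2 \<in> VB"
    using A.eV_in B.eV_in \<sigma> m\<sigma> by auto
  have nA: "x \<notin> VA" if "x \<in> VB" for x using that disj by auto
  have tree: "mtree ?V ?E D"
    unfolding D_def by (rule mtree.join[OF A.mtree B.mtree disj e1 e2])
  have DA: "D x y = DA x y" if "x \<in> VA" "y \<in> VA" for x y using that by (simp add: D_def join_dist_def)
  have DB: "D x y = DB x y" if "x \<in> VB" "y \<in> VB" for x y using that nA by (simp add: D_def join_dist_def)
  have DAB: "D x y = DA x ?e1 + dist ?e1 ?e2 + DB ?e2 y" if "x \<in> VA" "y \<in> VB" for x y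
    using that nA by (simp add: D_def join_dist_def)
  have sym: "D x y = D y x" if "x \<in> ?V" "y \<in> ?V" for x y
    using mtree_dist_sym[OF tree] that by blast
  have symA: "DA x y = DA y x" if "x \<in> VA" "y \<in> VA" for x y
    using mtree_dist_sym[OF A.mtree] that by blast
  have symB: "DB x y = DB y x" if "x \<in> VB" "y \<in> VB" for x y
    using mtree_dist_sym[OF B.mtree] that by blast
  show "\<forall>x\<in>VA. \<forall>y\<in>VA. D x y = DA x y" "\<forall>x\<in>VB. \<forall>y\<in>VB. D x y = DB x y" using DA DB by auto
  define g where "g = dist ?e1 ?e2"
  define \<rho>1 where "\<rho>1 = ?h (s0 + \<sigma> * b) ?e1"
  define \<rho>2 where "\<rho>2 = ?h (s0 - \<sigma> * b) ?e2"
  have hn: "0 \<le> hdist S L p l x" for p l x by (rule hdist_nonneg)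
  have pos: "0 \<le> \<rho>1" "0 \<le> \<rho>2" by (auto simp: \<rho>1_def \<rho>2_def hn)
  have "\<bar>(s0 - \<sigma> * b) - (s0 + \<sigma> * b)\<bar> = 2 * b" using \<sigma> b by auto
  then have g1: "g \<le> \<rho>1 + 2 * b + \<rho>2"
    using dist_le_hdist'[OF c, of ?e1 ?e2 "s0 + \<sigma> * b" l0 "s0 - \<sigma> * b"]
    unfolding g_def \<rho>1_def \<rho>2_def by simp
  show "\<forall>x\<in>VA. \<forall>y\<in>VB. D x y \<le> DA x ?e1 + ?h (s0 + \<sigma> * b) ?e1 + 2 * b
      + (DB y ?e2 + ?h (s0 - \<sigma> * b) ?e2)"
    using DAB g1 symB e2 unfolding g_def \<rho>1_def \<rho>2_def by fastforce
  have boxS: "\<bar>S x - s0\<bar> \<le> 3 * b" if "x \<in> ?V" for x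
    using child_box(2)[OF A \<sigma>] child_box(2)[OF B m\<sigma>] that by auto
  have boxL: "\<bar>L x - l0\<bar> \<le> q" if "x \<in> ?V" for x using A.box_L B.box_L that unfolding q by auto
  have e1V: "?e1 \<in> ?V" and e2V: "?e2 \<in> ?V" using e1 e2 by auto
  have far: "\<bar>S ?e1 - (s0 - \<sigma> * b)\<bar> \<le> 4 * b"
    using child_box(4)[OF A \<sigma> e1] boxS[OF e1V] by simp
  have g2: "g \<le> ?h (s0 - \<sigma> * b) ?e1 + \<rho>2"
    using dist_le_hdist[OF c, of ?e1 ?e2 "s0 - \<sigma> * b" l0] unfolding g_def \<rho>2_def by simp
  have g3: "g \<le> 4359/1000 * b + \<rho>2"
    using far_side_hole_bound[where S = S and L = L, OF b0 q far boxL[OF e1V]] g2 by simp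
  have t1: "?t s ?e1 \<le> \<rho>1 + 2 * b" if "s \<in> {-1, 1}" for s
    unfolding \<rho>1_def by (rule hdist_perp_hole[OF b q \<sigma> that])
  have t2: "?t s ?e1 \<le> 4583/1000 * b" if "s \<in> {-1, 1}" for s
    by (rule perp_hole_bound[where S = S and L = L, OF b0 q boxS[OF e1V] boxL[OF e1V] that])
  have ee: "D ?e1 ?e1 = 0" using mtree_dist_self[OF tree] e1V by blast
  have vA: "DA ?f1 ?e1 + ?h (s0 + 3 * \<sigma> * b) ?f1 + \<rho>1 \<le> 9/2 * b"
    unfolding \<rho>1_def by (rule child_VV[OF A \<sigma>])
  have vB: "DB ?f2 ?e2 + ?h (s0 - 3 * \<sigma> * b) ?f2 + \<rho>2 \<le> 9/2 * b"
    unfolding \<rho>2_def using child_VV[OF B m\<sigma>] by simp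
  have two: "s = \<sigma> \<or> s = - \<sigma>" if "s \<in> {-1, 1}" for s using that \<sigma> by auto
  have \<sigma>0: "\<sigma> \<noteq> - \<sigma>" using \<sigma> by auto
  \<comment> \<open>the only estimate that needs \<open>e1\<close> to be the entry closer to the axis\<close>
  have perp: "DB x ?e2 + g + ?t s ?e1 \<le> 9/4 * \<bar>L x - (l0 + s * q)\<bar> + 81/4 * b"
    if x: "x \<in> VB" and s: "s \<in> {-1, 1}" for x s
  proof -
    have in2: "DB x ?e2 + \<rho>2 \<le> 49/4 * b" using child_in2[OF B m\<sigma> x] unfolding \<rho>2_def by simp
    have L0: "0 \<le> \<bar>L x - (l0 + s * q)\<bar>" by simp
    \<comment> \<open>The crude total \<open>49/4 + sqrt 19 + sqrt 21\<close> exceeds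
      \<open>81/4\<close>, so every case has to gain something. For \<open>e1\<close> in the middle
      third the two roots drop to \<open>sqrt (49/3)\<close> and \<open>sqrt (43/3)\<close>.\<close>
    show ?thesis
    proof (cases "\<bar>L ?e1 - l0\<bar> \<le> q / 3")
      case True
      have "?h (s0 - \<sigma> * b) ?e1 \<le> 405/100 * b"
        by (rule far_side_hole_bound_mid[where S = S and L = L, OF b0 q far True])
      moreover have "?t s ?e1 \<le> 379/100 * b"
        by (rule perp_hole_bound_mid[where S = S and L = L, OF b0 q boxS[OF e1V] True s])
      ultimately show ?thesis using in2 g2 L0 b by argo
    next
      case False
      \<comment> \<open>Now \<open>e2\<close> is outside the middle third as well, so the second
        alternative of \<open>I\<close> holds for the child \<open>B\<close>: points on the side of
        \<open>e2\<close> reach it cheaply.\<close>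
      then have n2: "\<not> \<bar>L ?e2 - l0\<bar> \<le> q / 3" using closer by simp
      then have J: "(L x - l0) * (L ?e2 - l0) > 0 \<Longrightarrow> DB x ?e2 \<le> 49/12 * q"
        using B.I \<sigma> x unfolding q by auto
      have "\<bar>S ?e1 - S ?e2\<bar> \<le> 6 * b" "\<bar>L ?e1 - L ?e2\<bar> \<le> 2 * q"
        using boxS[OF e1V] boxS[OF e2V] boxL[OF e1V] boxL[OF e2V] by auto
      then have "sqrt ((S ?e1 - S ?e2)\<^sup>2 + (L ?e1 - L ?e2)\<^sup>2) \<le> 693/100 * b"
        by (rule sqrt_sum_le) (use b in \<open>auto simp: power_mult_distrib q2[OF b0 q] power_divide\<close>)
      then have g4: "g \<le> 693/100 * b"
        using c unfolding g_def plane_coords_def by simp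
      \<comment> \<open>In the first case \<open>I\<close> applies to \<open>x\<close>. In the
        second \<open>x\<close> is across the axis from the hole, which makes \<open>9/4 * q\<close>
        available. In the third \<open>e2\<close> is across the axis from the hole, so the bridge or
        the way from \<open>e1\<close> to the hole is short.\<close>
      consider "(L x - l0) * (L ?e2 - l0) > 0"
        | "s * (L ?e2 - l0) > 0" "s * (L x - l0) \<le> 0"
        | "s * (L ?e2 - l0) < 0"
      proof -
        have "L ?e2 - l0 \<noteq> 0" using n2 qb b by auto
        then show ?thesis using that s
          by (cases "L x \<le> l0"; cases "l0 \<le> L x"; cases "L ?e2 < l0")
            (auto simp: mult_less_0_iff zero_less_mult_iff not_less not_le)
      qed
      then show ?thesis
      proof cases
        case 1
        then show ?thesis using J g4 t2[OF s] qb b L0 by argo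
      next
        case 2
        then have "q \<le> \<bar>L x - (l0 + s * q)\<bar>" using s qb b by auto
        then show ?thesis using in2 g3 t2[OF s] qb b by argo
      next
        case 3
        \<comment> \<open>Since \<open>in2\<close> already contains \<open>\<rho>2\<close>, exactly
          \<open>81/4 - 49/4 = 8\<close> times \<open>b\<close> is left for the bridge and the way
          to the hole.\<close>
        have "g + ?t s ?e1 \<le> 8 * b + \<rho>2"
        proof (cases "s * (L ?e1 - l0) \<ge> 0")
          case True
          then have "\<bar>L ?e1 - (l0 + s * q)\<bar> \<le> q" using boxL[OF e1V] s by auto
          then have "?t s ?e1 \<le> 347/100 * b" by (rule perp_hole_bound_near[where S = S and L = L, OF b0 q boxS[OF e1V]])
          then show ?thesis using g3 b by argo
        next
          case same: False
          \<comment> \<open>Both entries are on the same side of the axis, so the bridge covers only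
            \<open>v2 - v1\<close> in direction \<open>L\<close>; \<open>closer\<close> supplies
            \<open>v1 \<le> v2\<close>, and a large \<open>v2\<close> makes \<open>\<rho>2\<close>
            large.\<close>
          define v1 v2 where "v1 = \<bar>L ?e1 - l0\<bar>" and "v2 = \<bar>L ?e2 - l0\<bar>"
          define y where "y = \<bar>S ?e2 - (s0 - \<sigma> * b)\<bar>"
          have "\<rho>2 = sqrt (y\<^sup>2 + v2\<^sup>2)" by (simp add: \<rho>2_def hdist_def y_def v2_def)
          moreover have "g = sqrt ((S ?e1 - S ?e2)\<^sup>2 + (v2 - v1)\<^sup>2)"
          proof -
            have "(L ?e1 - L ?e2)\<^sup>2 = (v2 - v1)\<^sup>2"
              using same 3 s unfolding v1_def v2_def by (auto simp: power2_eq_square algebra_simps)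
            then show ?thesis using c unfolding g_def plane_coords_def by simp
          qed
          moreover have "?t s ?e1 \<le> sqrt ((3 * b)\<^sup>2 + (q + v1)\<^sup>2)"
          proof -
            have "\<bar>L ?e1 - (l0 + s * q)\<bar> \<le> q + v1"
              using same s qb b unfolding v1_def by auto
            then have "\<bar>L ?e1 - (l0 + s * q)\<bar> \<le> \<bar>q + v1\<bar>" "\<bar>S ?e1 - s0\<bar> \<le> \<bar>3 * b\<bar>"
              using boxS[OF e1V] by auto
            then show ?thesis unfolding hdist_def abs_le_square_iff
              by (intro real_sqrt_le_mono add_mono)
          qed
          moreover have "sqrt ((S ?e1 - S ?e2)\<^sup>2 + (v2 - v1)\<^sup>2) + sqrt ((3 * b)\<^sup>2 + (q + v1)\<^sup>2)
              \<le> 8 * b + sqrt (y\<^sup>2 + v2\<^sup>2)"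
          proof (rule opposite_entries_bound[OF b0 q])
            show "0 \<le> y" "0 \<le> v1" by (auto simp: y_def v1_def)
            show "y \<le> 2 * b" using child_box(3)[OF B m\<sigma> e2] boxS[OF e2V] unfolding y_def by simp
            show "v1 \<le> v2" using closer unfolding v1_def v2_def .
            show "v2 \<le> q" using boxL[OF e2V] unfolding v2_def .
            show "\<bar>S ?e1 - S ?e2\<bar> \<le> 4 * b + y" using far unfolding y_def by auto
          qed
          ultimately show ?thesis by simp
        qed
        then show ?thesis using in2 L0 b by argo
      qed
    qed
  qed
  show ?cell
  proof (rule cell_tree_parentI[OF b q tree boxL boxS])
    fix s :: real assume s: "s \<in> {-1, 1}"
    let ?eU = "\<lambda>s. if s = \<sigma> then aV s else bV s"
    show "?eU s \<in> ?V" using two[OF s] f1 f2 \<sigma>0 by auto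
    show "?e1 \<in> ?V" by (rule e1V)
    have "D ?f1 ?f2 + ?h (s0 + 3 * \<sigma> * b) ?f1 + ?h (s0 - 3 * \<sigma> * b) ?f2 \<le> 27/2 * b"
      using DAB[OF f1 f2] vA vB g1 symB[OF e2 f2] b unfolding g_def by argo
    then show "D (?eU s) (?eU (- s)) + ?h (s0 + 3 * s * b) (?eU s) + ?h (s0 - 3 * s * b) (?eU (- s))
        \<le> 27/2 * b"
      using two[OF s] \<sigma>0 sym[of ?f1 ?f2] f1 f2 by auto
    show "D ?e1 ?e1 + ?t s ?e1 + hdist S L s0 (l0 - s * q) ?e1 \<le> 9/2 * q"
      using perp_holes_sum_bound[where S = S and L = L, OF b0 q boxS[OF e1V] boxL[OF e1V]] ee s by auto
    fix t :: real assume t: "t \<in> {-1, 1}"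
    show "D (?eU s) ?e1 + ?h (s0 + 3 * s * b) (?eU s) + ?t t ?e1 \<le> 8 * q"
      using two[OF s]
    proof
      assume "s = \<sigma>"
      then show ?thesis using vA t1[OF t] DA[OF f1 e1] qb b pos by simp
    next
      assume "s = - \<sigma>"
      moreover have "D ?f2 ?e1 = DB ?f2 ?e2 + g"
        using DAB[OF e1 f2] sym[of ?f2 ?e1] DA[OF e1 e1] ee symB[OF e2 f2] e1 f2 unfolding g_def by simp
      ultimately show ?thesis using vB g3 t2[OF t] qb b \<sigma>0 by simp
    qed
  next
    fix x s assume x: "x \<in> ?V" and s: "(s::real) \<in> {-1, 1}"
    let ?eU = "\<lambda>s. if s = \<sigma> then aV s else bV s"
    have n1: "s0 + 3 * - \<sigma> * b = s0 - 3 * \<sigma> * b" "s0 + - \<sigma> * b = s0 - \<sigma> * b"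
      "s0 - - \<sigma> * b = s0 + \<sigma> * b" "s0 - 3 * - \<sigma> * b = s0 + 3 * \<sigma> * b" by auto
    have L0: "0 \<le> \<bar>L x - (l0 + s * q)\<bar>" "0 \<le> \<bar>L x - l0\<bar>" by auto
    have "D x (?eU s) + ?h (s0 + 3 * s * b) (?eU s)
          \<le> 9/4 * \<bar>S x - (s0 + 3 * s * b)\<bar> + 81/4 * \<bar>L x - l0\<bar> \<and>
        D x (?eU s) + ?h (s0 + 3 * s * b) (?eU s) \<le> 123/10 * q \<and>
        D x ?e1 + ?t s ?e1 \<le> 9/4 * \<bar>L x - (l0 + s * q)\<bar> + 81/4 * \<bar>S x - s0\<bar> \<and>
        D x ?e1 + ?t s ?e1 \<le> 49/4 * q \<and>
        D x ?e1 + ?t s ?e1 \<le> 8 * q + 81/4 * \<bar>L x - l0\<bar>"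
      using x
    proof
      assume x: "x \<in> VA"
      note box = child_box[OF A \<sigma> x]
        and inn = child_in1[OF A \<sigma> x, folded \<rho>1_def] child_in2[OF A \<sigma> x, folded \<rho>1_def]
        and outt = child_out1[OF A \<sigma> x] child_out2[OF A \<sigma> x]
      have x1: "D x ?e1 = DA x ?e1" "D x ?f1 = DA x ?f1" using DA x e1 f1 by auto
      have x2: "D x ?f2 = DA x ?e1 + g + DB ?f2 ?e2"
        using DAB[OF x f2] symB[OF e2 f2] unfolding g_def by simp
      have "D x (?eU s) + ?h (s0 + 3 * s * b) (?eU s)
            \<le> 9/4 * \<bar>S x - (s0 + 3 * s * b)\<bar> + 81/4 * \<bar>L x - l0\<bar> \<and>
          D x (?eU s) + ?h (s0 + 3 * s * b) (?eU s) \<le> 123/10 * q"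
        using two[OF s]
      proof
        assume s: "s = \<sigma>"
        show ?thesis unfolding s if_P[OF refl]
          using outt box x1 qb b by (intro conjI; argo)
      next
        assume s: "s = - \<sigma>"
        show ?thesis unfolding s if_not_P[OF \<sigma>0[symmetric]] n1
          using inn box x2 vB g1 qb b by (intro conjI; argo)
      qed
      moreover have "D x ?e1 + ?t s ?e1 \<le> 9/4 * \<bar>L x - (l0 + s * q)\<bar> + 81/4 * \<bar>S x - s0\<bar> \<and>
          D x ?e1 + ?t s ?e1 \<le> 49/4 * q \<and> D x ?e1 + ?t s ?e1 \<le> 8 * q + 81/4 * \<bar>L x - l0\<bar>"
        using inn box x1 t1[OF s] L0 qb b by (intro conjI; argo)
      ultimately show ?thesis by blast
    next
      assume x: "x \<in> VB"
      note box = child_box[OF B m\<sigma> x, unfolded n1 minus_minus]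
        and inn = child_in1[OF B m\<sigma> x, unfolded n1 minus_minus, folded \<rho>2_def]
          child_in2[OF B m\<sigma> x, unfolded n1 minus_minus, folded \<rho>2_def]
        and outt = child_out1[OF B m\<sigma> x, unfolded n1 minus_minus] child_out2[OF B m\<sigma> x, unfolded n1 minus_minus]
      have x1: "D x ?f2 = DB x ?f2" using DB x f2 by auto
      have x2: "D x ?f1 = DB x ?e2 + g + DA ?f1 ?e1"
        using DAB[OF f1 x] sym[of x ?f1] symB[OF e2 x] x f1 unfolding g_def by simp
      have x3: "D x ?e1 = DB x ?e2 + g"
        using DAB[OF e1 x] sym[of x ?e1] symB[OF e2 x] DA[OF e1 e1] ee x e1 unfolding g_def by simp
      have "D x (?eU s) + ?h (s0 + 3 * s * b) (?eU s)
            \<le> 9/4 * \<bar>S x - (s0 + 3 * s * b)\<bar> + 81/4 * \<bar>L x - l0\<bar> \<and>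
          D x (?eU s) + ?h (s0 + 3 * s * b) (?eU s) \<le> 123/10 * q"
        using two[OF s]
      proof
        assume s: "s = \<sigma>"
        show ?thesis unfolding s if_P[OF refl]
          using inn box x2 vA g1 qb b by (intro conjI; argo)
      next
        assume s: "s = - \<sigma>"
        show ?thesis unfolding s if_not_P[OF \<sigma>0[symmetric]] n1
          using outt box x1 qb b by (intro conjI; argo)
      qed
      moreover have "D x ?e1 + ?t s ?e1 \<le> 9/4 * \<bar>L x - (l0 + s * q)\<bar> + 81/4 * \<bar>S x - s0\<bar> \<and>
          D x ?e1 + ?t s ?e1 \<le> 49/4 * q \<and> D x ?e1 + ?t s ?e1 \<le> 8 * q + 81/4 * \<bar>L x - l0\<bar>"
        using inn box x3 perp[OF x s] g3 t2[OF s] L0 qb b by (intro conjI; argo)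
      ultimately show ?thesis by blast
    qed
    then show "D x (?eU s) + ?h (s0 + 3 * s * b) (?eU s)
          \<le> 9/4 * \<bar>S x - (s0 + 3 * s * b)\<bar> + 81/4 * \<bar>L x - l0\<bar>"
        "D x (?eU s) + ?h (s0 + 3 * s * b) (?eU s) \<le> 123/10 * q"
        "D x ?e1 + ?t s ?e1 \<le> 9/4 * \<bar>L x - (l0 + s * q)\<bar> + 81/4 * \<bar>S x - s0\<bar>"
        "D x ?e1 + ?t s ?e1 \<le> 49/4 * q"
        "D x ?e1 + ?t s ?e1 \<le> 8 * q + 81/4 * \<bar>L x - l0\<bar>" by blast+
  next
    \<comment> \<open>The second alternative of \<open>I\<close> for the parent: points on the side
      of \<open>e1\<close> belong to \<open>VA\<close> and reach \<open>e1\<close> without the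
      bridge.\<close>
    have "D x ?e1 \<le> 49/4 * b" if x: "x \<in> ?V" and p: "(S x - s0) * (S ?e1 - s0) > 0" for x
    proof -
      have "x \<notin> VB"
      proof
        assume "x \<in> VB"
        then have "(- \<sigma>) * (S x - s0) \<ge> 0" "\<sigma> * (S ?e1 - s0) \<ge> 0"
          using child_box(7)[OF B m\<sigma>, of x] child_box(7)[OF A \<sigma> e1] by auto
        then show False using p \<sigma> by (auto simp: zero_less_mult_iff)
      qed
      then have "x \<in> VA" using x by auto
      then show ?thesis using child_in2[OF A \<sigma>, of x] DA[of x ?e1] e1 pos unfolding \<rho>1_def by simp
    qed
    then show "(\<forall>s\<in>{-1, 1}. \<bar>S ?e1 - s0\<bar> \<le> b) \<or> ?e1 = ?e1 \<and>
      (\<forall>x\<in>?V. (S x - s0) * (S ?e1 - s0) > 0 \<longrightarrow> D x ?e1 \<le> 49/4 * b)" by blast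
  qed
qed

lemma cell_tree_join_outer:
  fixes S L :: "'a::metric_space \<Rightarrow> real"
  assumes c: "plane_coords S L" and b: "0 < b" and q: "q = sqrt 3 * b"
    and Lc: "cell_tree b S L (s0 + 2 * (-1) * b) l0 VL EL DL lU lV"
    and Rc: "cell_tree b S L (s0 + 2 * 1 * b) l0 VR ER DR rU rV"
    and disj: "VL \<inter> VR = {}"
  shows "\<exists>E D eU eV. cell_tree q L S l0 s0 (VL \<union> VR) E D eU eV \<and>
    (\<forall>x\<in>VL. \<forall>y\<in>VL. D x y = DL x y) \<and> (\<forall>x\<in>VR. \<forall>y\<in>VR. D x y = DR x y) \<and>
    (\<forall>x\<in>VL. \<forall>y\<in>VR. D x y \<le> DL x (lV 1) + hdist S L (s0 - b) l0 (lV 1) + 2 * b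
       + (DR y (rV (-1)) + hdist S L (s0 + b) l0 (rV (-1))))"
proof (cases "\<bar>L (lV 1) - l0\<bar> \<le> \<bar>L (rV (-1)) - l0\<bar>")
  case True
  have s: "(-1::real) \<in> {-1, 1}" and R': "cell_tree b S L (s0 + 2 * (- (-1)) * b) l0 VR ER DR rU rV"
    using Rc by auto
  from True have "\<bar>L (lV (- (-1))) - l0\<bar> \<le> \<bar>L (rV (-1)) - l0\<bar>" by simp
  note st = cell_tree_outer_pair[OF c b q s Lc R' disj this]
  show ?thesis
    by (intro exI conjI) (rule st(1), rule st(2), rule st(3), use st(4) in simp)
next
  case False
  have s: "(1::real) \<in> {-1, 1}" and disj': "VR \<inter> VL = {}" using disj by auto
  from False have "\<bar>L (rV (- 1)) - l0\<bar> \<le> \<bar>L (lV 1) - l0\<bar>" by simp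
  note st = cell_tree_outer_pair[OF c b q s Rc Lc disj' this]
  define D where "D = join_dist VR DR DL (rV (-1)) (lV 1)"
  have ct: "\<exists>E eU eV. cell_tree q L S l0 s0 (VR \<union> VL) E D eU eV"
    unfolding D_def using st(1) by blast
  then obtain E eU eV where ct: "cell_tree q L S l0 s0 (VR \<union> VL) E D eU eV" by blast
  have "D x y = D y x" if "x \<in> VL" "y \<in> VR" for x y
    using mtree_dist_sym[OF cell_tree.mtree[OF ct]] that by blast
  moreover have "\<forall>x\<in>VR. \<forall>y\<in>VL. D x y \<le> DR x (rV (-1)) + hdist S L (s0 + b) l0 (rV (-1)) + 2 * b
       + (DL y (lV 1) + hdist S L (s0 - b) l0 (lV 1))"
    using st(4) unfolding D_def by simp
  ultimately have "\<forall>x\<in>VL. \<forall>y\<in>VR. D x y \<le> DL x (lV 1) + hdist S L (s0 - b) l0 (lV 1) + 2 * b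
       + (DR y (rV (-1)) + hdist S L (s0 + b) l0 (rV (-1)))" by fastforce
  moreover have "\<forall>x\<in>VR. \<forall>y\<in>VR. D x y = DR x y" "\<forall>x\<in>VL. \<forall>y\<in>VL. D x y = DL x y"
    using st(2,3) unfolding D_def by blast+
  ultimately show ?thesis using ct by (metis Un_commute)
qed

section \<open>Tree distances between points of different children\<close>

definition facing_cost ::
    "('a \<Rightarrow> real) \<Rightarrow> ('a \<Rightarrow> real) \<Rightarrow> real \<Rightarrow> real \<Rightarrow> real \<Rightarrow> ('a \<Rightarrow> 'a \<Rightarrow> real) \<Rightarrow> (real \<Rightarrow> 'a) \<Rightarrow>
     real \<Rightarrow> 'a \<Rightarrow> real" where
  "facing_cost S L b s0 l0 D eV s x = D x (eV s) + hdist S L (s0 + s * b) l0 (eV s)"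

text \<open>Uniform form of all patterns of empty children. The charge \<open>9/2 * b\<close>
  between the outer children covers a crossing of the middle child as well as the gap of
  \<open>2 * b\<close> left by an empty one.\<close>

lemma cell_tree_join:
  fixes S L :: "'a::metric_space \<Rightarrow> real" and V :: "real \<Rightarrow> 'a set"
  assumes c: "plane_coords S L" and b: "0 < b" and q: "q = sqrt 3 * b"
    and child: "\<And>\<sigma>. \<sigma> \<in> {-1, 0, 1} \<Longrightarrow> V \<sigma> = {} \<or>
      cell_tree b S L (s0 + 2 * \<sigma> * b) l0 (V \<sigma>) (E \<sigma>) (D \<sigma>) (gU \<sigma>) (gV \<sigma>)"
    and disj: "\<And>\<sigma> \<tau>. \<sigma> \<in> {-1, 0, 1} \<Longrightarrow> \<tau> \<in> {-1, 0, 1} \<Longrightarrow> \<sigma> \<noteq> \<tau> \<Longrightarrow> V \<sigma> \<inter> V \<tau> = {}"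
    and ne: "V (-1) \<union> V 0 \<union> V 1 \<noteq> {}"
  shows "\<exists>E' D' eU eV. cell_tree q L S l0 s0 (V (-1) \<union> V 0 \<union> V 1) E' D' eU eV \<and>
    (\<forall>\<sigma>\<in>{-1, 0, 1}. \<forall>x\<in>V \<sigma>. \<forall>y\<in>V \<sigma>. D' x y = D \<sigma> x y) \<and>
    (\<forall>\<sigma>\<in>{-1, 0, 1}. \<forall>\<tau>\<in>{-1, 0, 1}. \<sigma> < \<tau> \<longrightarrow> (\<forall>x\<in>V \<sigma>. \<forall>y\<in>V \<tau>.
      D' x y \<le> facing_cost S L b (s0 + 2 * \<sigma> * b) l0 (D \<sigma>) (gV \<sigma>) 1 x
        + (if \<tau> - \<sigma> = 2 then 9/2 * b else 0)
        + facing_cost S L b (s0 + 2 * \<tau> * b) l0 (D \<tau>) (gV \<tau>) (-1) y))"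
proof -
  have f: "facing_cost S L b (s0 + 2 * (-1) * b) l0 (D (-1)) (gV (-1)) 1 x
        = D (-1) x (gV (-1) 1) + hdist S L (s0 - b) l0 (gV (-1) 1)"
      "facing_cost S L b (s0 + 2 * 1 * b) l0 (D 1) (gV 1) (-1) x
        = D 1 x (gV 1 (-1)) + hdist S L (s0 + b) l0 (gV 1 (-1))"
      "facing_cost S L b (s0 + 2 * 0 * b) l0 (D 0) (gV 0) 1 x
        = D 0 x (gV 0 1) + hdist S L (s0 + b) l0 (gV 0 1)"
      "facing_cost S L b (s0 + 2 * 0 * b) l0 (D 0) (gV 0) (-1) x
        = D 0 x (gV 0 (-1)) + hdist S L (s0 - b) l0 (gV 0 (-1))" for x
    by (auto simp: facing_cost_def algebra_simps)
  have Lc: "V (-1) = {} \<or> cell_tree b S L (s0 + 2 * (-1) * b) l0 (V (-1)) (E (-1)) (D (-1)) (gU (-1)) (gV (-1))"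
    and Rc: "V 1 = {} \<or> cell_tree b S L (s0 + 2 * 1 * b) l0 (V 1) (E 1) (D 1) (gU 1) (gV 1)"
    using child[of "-1"] child[of 1] by auto
  have Mc: "V 0 = {} \<or> cell_tree b S L s0 l0 (V 0) (E 0) (D 0) (gU 0) (gV 0)"
    using child[of 0] by simp
  have d: "V (-1) \<inter> V 0 = {}" "V (-1) \<inter> V 1 = {}" "V 0 \<inter> V 1 = {}"
    using disj[of "-1" 0] disj[of "-1" 1] disj[of 0 1] by auto
  consider "V 0 \<noteq> {}" | "V 0 = {}" "V (-1) \<noteq> {}" "V 1 \<noteq> {}"
    | "V 0 = {}" "V (-1) = {}" "V 1 \<noteq> {}" | "V 0 = {}" "V (-1) \<noteq> {}" "V 1 = {}"
    using ne by blast
  then show ?thesis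
  proof cases
    case 1
    with Mc have "cell_tree b S L s0 l0 (V 0) (E 0) (D 0) (gU 0) (gV 0)" by simp
    from cell_tree_join_middle[OF c b q this Lc Rc d] obtain E' D' eU eV where
      ct: "cell_tree q L S l0 s0 (V (-1) \<union> V 0 \<union> V 1) E' D' eU eV"
      and ag: "\<forall>x\<in>V (-1). \<forall>y\<in>V (-1). D' x y = D (-1) x y" "\<forall>x\<in>V 0. \<forall>y\<in>V 0. D' x y = D 0 x y"
        "\<forall>x\<in>V 1. \<forall>y\<in>V 1. D' x y = D 1 x y"
      and cr: "\<forall>x\<in>V (-1). \<forall>y\<in>V 0. D' x y \<le> D (-1) x (gV (-1) 1) + hdist S L (s0 - b) l0 (gV (-1) 1)
         + (D 0 y (gV 0 (-1)) + hdist S L (s0 - b) l0 (gV 0 (-1)))"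
        "\<forall>x\<in>V 1. \<forall>y\<in>V 0. D' x y \<le> D 1 x (gV 1 (-1)) + hdist S L (s0 + b) l0 (gV 1 (-1))
         + (D 0 y (gV 0 1) + hdist S L (s0 + b) l0 (gV 0 1))"
        "\<forall>x\<in>V 1. \<forall>y\<in>V (-1). D' x y \<le> D 1 x (gV 1 (-1)) + hdist S L (s0 + b) l0 (gV 1 (-1)) + 9/2 * b
         + (D (-1) y (gV (-1) 1) + hdist S L (s0 - b) l0 (gV (-1) 1))"
      by blast
    have sym: "D' x y = D' y x" if "x \<in> V (-1) \<union> V 0 \<union> V 1" "y \<in> V (-1) \<union> V 0 \<union> V 1" for x y
      using mtree_dist_sym[OF cell_tree.mtree[OF ct]] that by blast
    have "D' x y \<le> facing_cost S L b (s0 + 2 * \<sigma> * b) l0 (D \<sigma>) (gV \<sigma>) 1 x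
        + (if \<tau> - \<sigma> = 2 then 9/2 * b else 0)
        + facing_cost S L b (s0 + 2 * \<tau> * b) l0 (D \<tau>) (gV \<tau>) (-1) y"
      if st: "\<sigma> \<in> {-1, 0, 1}" "\<tau> \<in> {-1, 0, 1}" "\<sigma> < \<tau>" and xy: "x \<in> V \<sigma>" "y \<in> V \<tau>" for \<sigma> \<tau> x y
    proof -
      consider "\<sigma> = -1" "\<tau> = 0" | "\<sigma> = 0" "\<tau> = 1" | "\<sigma> = -1" "\<tau> = 1" using st by auto
      then show ?thesis
      proof cases
        case 1
        show ?thesis using cr(1) xy unfolding 1 f by fastforce
      next
        case 2
        show ?thesis using cr(2) xy sym[of x y] unfolding 2 f by fastforce
      next
        case 3
        show ?thesis using cr(3) xy sym[of x y] unfolding 3 f by fastforce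
      qed
    qed
    then show ?thesis using ct ag
      by (intro exI[of _ E'] exI[of _ D'] exI[of _ eU] exI[of _ eV]) simp
  next
    case 2
    with Lc Rc have Lc': "cell_tree b S L (s0 + 2 * (-1) * b) l0 (V (-1)) (E (-1)) (D (-1)) (gU (-1)) (gV (-1))"
      and Rc': "cell_tree b S L (s0 + 2 * 1 * b) l0 (V 1) (E 1) (D 1) (gU 1) (gV 1)" by simp_all
    from cell_tree_join_outer[OF c b q Lc' Rc' d(2)] obtain E' D' eU eV where
      ct: "cell_tree q L S l0 s0 (V (-1) \<union> V 1) E' D' eU eV"
      and ag: "\<forall>x\<in>V (-1). \<forall>y\<in>V (-1). D' x y = D (-1) x y" "\<forall>x\<in>V 1. \<forall>y\<in>V 1. D' x y = D 1 x y"
      and cr: "\<forall>x\<in>V (-1). \<forall>y\<in>V 1. D' x y \<le> D (-1) x (gV (-1) 1) + hdist S L (s0 - b) l0 (gV (-1) 1)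
         + 2 * b + (D 1 y (gV 1 (-1)) + hdist S L (s0 + b) l0 (gV 1 (-1)))"
      by blast
    have "D' x y \<le> facing_cost S L b (s0 + 2 * \<sigma> * b) l0 (D \<sigma>) (gV \<sigma>) 1 x
        + (if \<tau> - \<sigma> = 2 then 9/2 * b else 0)
        + facing_cost S L b (s0 + 2 * \<tau> * b) l0 (D \<tau>) (gV \<tau>) (-1) y"
      if "\<sigma> \<in> {-1, 0, 1}" "\<tau> \<in> {-1, 0, 1}" "\<sigma> < \<tau>" "x \<in> V \<sigma>" "y \<in> V \<tau>" for \<sigma> \<tau> x y
    proof -
      have st: "\<sigma> = -1" "\<tau> = 1" using that 2(1) by auto
      show ?thesis using cr that(4,5) b unfolding st f by fastforce
    qed
    then show ?thesis using ct ag 2(1) by (intro exI[of _ E'] exI[of _ D'] exI[of _ eU] exI[of _ eV]) auto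
  next
    case 3
    have s: "(1::real) \<in> {-1, 1}" by simp
    from 3 Rc have "cell_tree q L S l0 s0 (V 1) (E 1) (D 1) (gV 1) (\<lambda>_. gV 1 (- 1))"
      using cell_tree_outer_only[OF b q s] by blast
    with 3 show ?thesis by (intro exI[of _ "E 1"] exI[of _ "D 1"] exI) auto
  next
    case 4
    have s: "(-1::real) \<in> {-1, 1}" by simp
    from 4 Lc have "cell_tree q L S l0 s0 (V (-1)) (E (-1)) (D (-1)) (gV (-1)) (\<lambda>_. gV (-1) (- (-1)))"
      using cell_tree_outer_only[OF b q s] by blast
    with 4 show ?thesis by (intro exI[of _ "E (-1)"] exI[of _ "D (-1)"] exI) auto
  qed
qed

lemma facing_cost_bounds:
  assumes "cell_tree b S L p l0 V E D eU eV" "x \<in> V" "s \<in> {-1, 1}"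
  shows "facing_cost S L b p l0 D eV s x \<le> 9/4 * (b - s * (S x - p)) + 81/4 * \<bar>L x - l0\<bar>"
    "facing_cost S L b p l0 D eV s x \<le> 49/4 * b"
    "facing_cost S L b p l0 D eV s x \<le> 8 * b + 81/4 * \<bar>S x - p\<bar>"
proof -
  interpret cell_tree b S L p l0 V E D eU eV by fact
  have "\<bar>S x - (p + s * b)\<bar> = b - s * (S x - p)"
    using box_S[OF assms(2)] assms(3) by auto
  then show "facing_cost S L b p l0 D eV s x \<le> 9/4 * (b - s * (S x - p)) + 81/4 * \<bar>L x - l0\<bar>"
    "facing_cost S L b p l0 D eV s x \<le> 49/4 * b"
    "facing_cost S L b p l0 D eV s x \<le> 8 * b + 81/4 * \<bar>S x - p\<bar>"
    unfolding facing_cost_def using BV1[OF assms(2,3)] BV2[OF assms(2,3)] BV3[OF assms(2,3)] by auto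
qed

context
  fixes S L :: "'a::metric_space \<Rightarrow> real" and b s0 l0 \<sigma> \<tau> r :: real and x y :: 'a
    and V1 V2 E1 E2 D1 D2 u1 u2 v1 v2
  assumes b: "0 < b" and st: "\<sigma> \<in> {-1, 0, 1}" "\<tau> \<in> {-1, 0, 1}" "\<sigma> < \<tau>"
    and c1: "cell_tree b S L (s0 + 2 * \<sigma> * b) l0 V1 E1 D1 u1 v1" and x: "x \<in> V1"
    and c2: "cell_tree b S L (s0 + 2 * \<tau> * b) l0 V2 E2 D2 u2 v2" and y: "y \<in> V2"
    and r: "r \<le> facing_cost S L b (s0 + 2 * \<sigma> * b) l0 D1 v1 1 x
        + (if \<tau> - \<sigma> = 2 then 9/2 * b else 0)
        + facing_cost S L b (s0 + 2 * \<tau> * b) l0 D2 v2 (-1) y"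
begin

text \<open>The offsets from the axis \<open>l0\<close> add up to the displacement in direction
  \<open>L\<close>. In direction \<open>S\<close> the terms telescope, because a crossed middle
  child of width \<open>2 * b\<close> is charged \<open>9/4\<close> per unit of length.\<close>

lemma straddling_pair_bound:
  assumes "(L x - l0) * (L y - l0) \<le> 0"
  shows "r \<le> 9/4 * \<bar>S x - S y\<bar> + 81/4 * \<bar>L x - L y\<bar>"
proof -
  have l: "\<bar>L x - l0\<bar> + \<bar>L y - l0\<bar> = \<bar>L x - L y\<bar>"
    using assms by (auto simp: mult_le_0_iff)
  have "r \<le> 9/4 * (b - (S x - (s0 + 2 * \<sigma> * b))) + 81/4 * \<bar>L x - l0\<bar>
      + (if \<tau> - \<sigma> = 2 then 9/2 * b else 0)
      + (9/4 * (b + (S y - (s0 + 2 * \<tau> * b))) + 81/4 * \<bar>L y - l0\<bar>)"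
  proof -
    have "facing_cost S L b (s0 + 2 * \<sigma> * b) l0 D1 v1 1 x
        \<le> 9/4 * (b - 1 * (S x - (s0 + 2 * \<sigma> * b))) + 81/4 * \<bar>L x - l0\<bar>"
      by (rule facing_cost_bounds(1)[OF c1 x]) simp
    moreover have "facing_cost S L b (s0 + 2 * \<tau> * b) l0 D2 v2 (-1) y
        \<le> 9/4 * (b - (-1) * (S y - (s0 + 2 * \<tau> * b))) + 81/4 * \<bar>L y - l0\<bar>"
      by (rule facing_cost_bounds(1)[OF c2 y]) simp
    ultimately show ?thesis using r by argo
  qed
  also have "\<dots> \<le> 9/4 * (S y - S x) + 81/4 * (\<bar>L x - l0\<bar> + \<bar>L y - l0\<bar>)"
  proof -
    consider "\<sigma> = -1" "\<tau> = 0" | "\<sigma> = 0" "\<tau> = 1" | "\<sigma> = -1" "\<tau> = 1" using st by auto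
    then show ?thesis by cases (simp_all, argo+)
  qed
  also have "\<dots> \<le> 9/4 * \<bar>S x - S y\<bar> + 81/4 * \<bar>L x - L y\<bar>"
  proof -
    have "S y - S x \<le> \<bar>S x - S y\<bar>" by linarith
    then show ?thesis unfolding l by simp
  qed
  finally show ?thesis .
qed

text \<open>For adjacent children the center line must belong to one of the two. The point of that
  child, at distance \<open>\<delta>\<close> from the line, pays
  \<open>8 * b + 81/4 * \<delta>\<close> and the other one \<open>49/4 * b\<close>; the points are
  at least \<open>b + \<delta>\<close> apart, so \<open>81/4 = 49/4 + 8\<close> suffices.\<close>

lemma separated_pair_bound:
  fixes j :: int
  assumes j: "S x \<le> s0 + 2 * of_int j * b" "s0 + 2 * of_int j * b \<le> S y"
  shows "r \<le> 81/4 * \<bar>S x - S y\<bar>"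
proof -
  have sx: "\<bar>S x - (s0 + 2 * \<sigma> * b)\<bar> \<le> b" using cell_tree.box_S[OF c1 x] .
  have sy: "\<bar>S y - (s0 + 2 * \<tau> * b)\<bar> \<le> b" using cell_tree.box_S[OF c2 y] .
  have f1: "facing_cost S L b (s0 + 2 * \<sigma> * b) l0 D1 v1 1 x \<le> 49/4 * b"
      "facing_cost S L b (s0 + 2 * \<sigma> * b) l0 D1 v1 1 x \<le> 8 * b + 81/4 * \<bar>S x - (s0 + 2 * \<sigma> * b)\<bar>"
    using facing_cost_bounds(2,3)[OF c1 x, of 1] by auto
  have f2: "facing_cost S L b (s0 + 2 * \<tau> * b) l0 D2 v2 (-1) y \<le> 49/4 * b"
      "facing_cost S L b (s0 + 2 * \<tau> * b) l0 D2 v2 (-1) y \<le> 8 * b + 81/4 * \<bar>S y - (s0 + 2 * \<tau> * b)\<bar>"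
    using facing_cost_bounds(2,3)[OF c2 y, of "-1"] by auto
  show ?thesis
  proof (cases "\<tau> - \<sigma> = 2")
    case True
    then have "\<sigma> = -1" "\<tau> = 1" using st by auto
    then have "2 * b \<le> \<bar>S x - S y\<bar>" using sx sy by auto
    then show ?thesis using r f1(1) f2(1) True b by simp
  next
    case False
    then have \<tau>: "\<tau> = \<sigma> + 1" using st by auto
    have "(2 * \<sigma> - 1) * b \<le> 2 * of_int j * b" "2 * of_int j * b \<le> (2 * \<tau> + 1) * b"
      using sx sy j by (auto simp: algebra_simps)
    then have "2 * \<sigma> - 1 \<le> 2 * of_int j" "2 * of_int j \<le> 2 * \<tau> + 1"
      using b by (auto simp: mult_le_cancel_right)
    moreover obtain m :: int where m: "\<sigma> = of_int m"
      using st(1) by (metis empty_iff insert_iff of_int_0 of_int_1 of_int_minus)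
    ultimately have "real_of_int (2 * m - 1) \<le> real_of_int (2 * j)" "real_of_int (2 * j) \<le> real_of_int (2 * m + 3)"
      using \<tau> by auto
    then have "j = m \<or> j = m + 1" by linarith
    then have "of_int j = \<sigma> \<or> of_int j = \<tau>" using \<tau> m by auto
    then show ?thesis
    proof
      assume "of_int j = \<sigma>"
      then have 1: "S x \<le> s0 + 2 * \<sigma> * b" using j by simp
      moreover have 2: "s0 + 2 * \<sigma> * b + b \<le> S y" using sy \<tau> by (simp add: algebra_simps)
      moreover from 1 2 have "\<bar>S x - (s0 + 2 * \<sigma> * b)\<bar> = s0 + 2 * \<sigma> * b - S x" "\<bar>S x - S y\<bar> = S y - S x"
        using b by auto
      ultimately show ?thesis using r f1(2) f2(1) unfolding if_not_P[OF False] by argo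
    next
      assume "of_int j = \<tau>"
      then have 1: "s0 + 2 * \<tau> * b \<le> S y" using j by simp
      moreover have 2: "S x \<le> s0 + 2 * \<tau> * b - b" using sx \<tau> by (simp add: algebra_simps)
      moreover from 1 2 have "\<bar>S y - (s0 + 2 * \<tau> * b)\<bar> = S y - (s0 + 2 * \<tau> * b)" "\<bar>S x - S y\<bar> = S y - S x"
        using b by auto
      ultimately show ?thesis using r f1(1) f2(2) unfolding if_not_P[OF False] by argo
    qed
  qed
qed

end

section \<open>Two shifted grids\<close>

definition grid_index :: "real \<Rightarrow> real \<Rightarrow> real \<Rightarrow> int" where
  "grid_index \<theta> h z = \<lfloor>z / (2 * h) + \<theta>\<rfloor>"

definition grid_center :: "real \<Rightarrow> real \<Rightarrow> int \<Rightarrow> real" where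
  "grid_center \<theta> h i = (of_int i + 1/2 - \<theta>) * (2 * h)"

lemma grid_center_dist:
  assumes "0 < h"
  shows "\<bar>z - grid_center \<theta> h (grid_index \<theta> h z)\<bar> \<le> h"
proof -
  have "of_int (grid_index \<theta> h z) \<le> z / (2 * h) + \<theta>" "z / (2 * h) + \<theta> < of_int (grid_index \<theta> h z) + 1"
    unfolding grid_index_def by linarith+
  then have "(of_int (grid_index \<theta> h z) - \<theta>) * (2 * h) \<le> z"
      "z \<le> (of_int (grid_index \<theta> h z) + 1 - \<theta>) * (2 * h)"
    using assms by (auto simp: field_simps)
  then show ?thesis unfolding grid_center_def by (auto simp: algebra_simps abs_le_iff)
qed

text \<open>Here \<open>3 * \<theta> = \<theta> + c\<close> with an integer \<open>c\<close>, so
  coarse walls are fine walls for the shift \<open>1/2\<close> as for the shift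
  \<open>0\<close>.\<close>

lemma grid_index_coarsen:
  assumes "2 * \<theta> = of_int c"
  shows "grid_index \<theta> (3 * h) z = (grid_index \<theta> h z + c) div 3"
proof -
  have "z / (2 * (3 * h)) + \<theta> = (z / (2 * h) + \<theta> + of_int c) / of_int 3"
    unfolding assms[symmetric] by simp
  then have "grid_index \<theta> (3 * h) z = \<lfloor>(z / (2 * h) + \<theta> + of_int c) / of_int 3\<rfloor>"
    unfolding grid_index_def by (simp only:)
  also have "\<dots> = \<lfloor>z / (2 * h) + \<theta> + of_int c\<rfloor> div 3" by (rule floor_divide_real_eq_div) simp
  finally show ?thesis by (simp add: grid_index_def)
qed

text \<open>The children of the interval \<open>K\<close> have the indices \<open>3 * K - c\<close>
  to \<open>3 * K - c + 2\<close>; the middle one shares its center.\<close>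

lemma grid_center_child:
  assumes "2 * \<theta> = of_int c"
  shows "grid_center \<theta> h i = grid_center \<theta> (3 * h) K + 2 * of_int (i - (3 * K - c + 1)) * h"
  using assms by (simp add: grid_center_def field_simps)

text \<open>The lines of the grid shifted by \<open>1/2 - \<theta>\<close> are the center lines of the grid shifted by \<open>\<theta>\<close>.\<close>
lemma other_grid_separates:
  assumes h: "0 < h" and c: "2 * \<theta> = of_int c"
    and "grid_index (1/2 - \<theta>) h z < grid_index (1/2 - \<theta>) h w"
  shows "\<exists>i. z \<le> grid_center \<theta> h i \<and> grid_center \<theta> h i \<le> w"
proof -
  define n where "n = grid_index (1/2 - \<theta>) h w"
  have 1: "of_int n \<le> w / (2 * h) + (1/2 - \<theta>)" unfolding n_def grid_index_def by linarith
  have 2: "z / (2 * h) + (1/2 - \<theta>) < of_int n"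
    using assms(3) unfolding n_def[symmetric] by (simp add: grid_index_def floor_less_iff)
  have "grid_center \<theta> h (n - 1 + c) = (of_int n - (1/2 - \<theta>)) * (2 * h)"
    using c by (simp add: grid_center_def field_simps)
  moreover have "z \<le> (of_int n - (1/2 - \<theta>)) * (2 * h)" "(of_int n - (1/2 - \<theta>)) * (2 * h) \<le> w"
    using 1 2 h by (auto simp: field_simps)
  ultimately show ?thesis by (metis)
qed

text \<open>Some center line lies between the points, and inside one interval of length
  \<open>2 * h\<close> only its own center qualifies.\<close>

lemma other_grid_straddles:
  assumes h: "0 < h" and c: "2 * \<theta> = of_int c"
    and ne: "grid_index (1/2 - \<theta>) h z \<noteq> grid_index (1/2 - \<theta>) h w"
    and i: "grid_index \<theta> h z = i" "grid_index \<theta> h w = i"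
  shows "(z - grid_center \<theta> h i) * (w - grid_center \<theta> h i) \<le> 0"
proof -
  have *: "(z - grid_center \<theta> h i) * (w - grid_center \<theta> h i) \<le> 0"
    if lt: "grid_index (1/2 - \<theta>) h z < grid_index (1/2 - \<theta>) h w"
      and i: "grid_index \<theta> h z = i" "grid_index \<theta> h w = i" for z w
  proof -
    obtain i' where i': "z \<le> grid_center \<theta> h i'" "grid_center \<theta> h i' \<le> w"
      using other_grid_separates[OF h c lt] by blast
    have b: "\<bar>z - grid_center \<theta> h i\<bar> \<le> h" "\<bar>w - grid_center \<theta> h i\<bar> \<le> h"
      using grid_center_dist[OF h] i by metis+
    have "grid_center \<theta> h i' - grid_center \<theta> h i = of_int (i' - i) * (2 * h)"
      by (simp add: grid_center_def algebra_simps)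
    then have "\<bar>of_int (i' - i) * (2 * h)\<bar> \<le> h" using b i' by auto
    then have "\<bar>of_int (i' - i)\<bar> * (2 * h) \<le> 1 * h" using h by (simp add: abs_mult)
    then have "\<bar>of_int (i' - i) :: real\<bar> < 1" using h by (auto simp: mult_le_cancel_right)
    then have "i' = i" by linarith
    then show ?thesis using i' by (simp add: mult_le_0_iff)
  qed
  show ?thesis using *[of z w] *[of w z] ne i by (auto simp: mult.commute linorder_neq_iff)
qed

lemma linear_form_le_dist:
  assumes "plane_coords S L"
  shows "9/4 * \<bar>S x - S y\<bar> + 81/4 * \<bar>L x - L y\<bar> \<le> 4 * sqrt 26 * dist x y"
proof -
  define u v where "u = \<bar>S x - S y\<bar>" and "v = \<bar>L x - L y\<bar>"
  have "9/4 * u + 81/4 * v \<le> sqrt (416 * (u\<^sup>2 + v\<^sup>2))"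
  proof (rule real_le_rsqrt)
    \<comment> \<open>The first square is the defect in Cauchy--Schwarz;
      \<open>81/16 + 6561/16\<close> is \<open>415.125\<close>.\<close>
    have "0 \<le> (81/4 * u - 9/4 * v)\<^sup>2 + (416 - (81/16 + 6561/16)) * (u\<^sup>2 + v\<^sup>2)"
      by (intro add_nonneg_nonneg mult_nonneg_nonneg) auto
    also have "\<dots> = 416 * (u\<^sup>2 + v\<^sup>2) - (9/4 * u + 81/4 * v)\<^sup>2"
      by (simp add: power2_eq_square field_simps)
    finally show "(9/4 * u + 81/4 * v)\<^sup>2 \<le> 416 * (u\<^sup>2 + v\<^sup>2)" by simp
  qed
  also have "\<dots> = 4 * sqrt 26 * sqrt (u\<^sup>2 + v\<^sup>2)"
  proof -
    have "(416::real) = 4\<^sup>2 * 26" by simp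
    then show ?thesis by (simp only: real_sqrt_mult real_sqrt_abs)
  qed
  finally show ?thesis using assms unfolding u_def v_def plane_coords_def by simp
qed

section \<open>The hierarchy of cells and its trees\<close>

locale plane_grid =
  fixes X Y :: "'a::metric_space \<Rightarrow> real" and b :: real and P :: "'a set"
  assumes coords: "plane_coords X Y" and b_pos: "0 < b"
begin

definition coord :: "nat \<Rightarrow> 'a \<Rightarrow> real" where
  "coord k = (if even k then X else Y)"

definition half :: "nat \<Rightarrow> real" where
  "half k = sqrt 3 ^ k * b"

definition idx :: "real \<Rightarrow> nat \<Rightarrow> 'a \<Rightarrow> int" where
  "idx \<theta> k x = grid_index \<theta> (half k) (coord k x)"

definition ctr :: "real \<Rightarrow> nat \<Rightarrow> int \<Rightarrow> real" where
  "ctr \<theta> k i = grid_center \<theta> (half k) i"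

text \<open>A cell of level \<open>k\<close> has index \<open>k\<close> in its short and index
  \<open>Suc k\<close> in its long direction. Its parent keeps the latter and replaces index
  \<open>k\<close> by index \<open>Suc (Suc k)\<close>, so a single sequence of indices describes
  all levels.\<close>

definition same_cell :: "real \<Rightarrow> nat \<Rightarrow> 'a \<Rightarrow> 'a \<Rightarrow> bool" where
  "same_cell \<theta> k x y \<longleftrightarrow> idx \<theta> k x = idx \<theta> k y \<and> idx \<theta> (Suc k) x = idx \<theta> (Suc k) y"

text \<open>The map to \<open>1/2 - \<theta>\<close> exchanges the two shifts \<open>0\<close> and
  \<open>1/2\<close>.\<close>

definition separated_by_both :: "real \<Rightarrow> nat \<Rightarrow> 'a \<Rightarrow> 'a \<Rightarrow> bool" where
  "separated_by_both \<theta> m x y \<longleftrightarrow>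
     same_cell \<theta> (Suc m) x y \<and> \<not> same_cell \<theta> m x y \<and> \<not> same_cell (1/2 - \<theta>) m x y"

lemma coords_level: "plane_coords (coord k) (coord (Suc k))"
  using coords plane_coords_commute by (auto simp: coord_def)

lemma coord_Suc_Suc: "coord (Suc (Suc k)) = coord k"
  by (simp add: coord_def)

lemma half_pos: "0 < half k" using b_pos by (simp add: half_def)

lemma half_Suc: "half (Suc k) = sqrt 3 * half k" by (simp add: half_def)

lemma half_Suc_Suc: "half (Suc (Suc k)) = 3 * half k"
  by (simp add: half_Suc flip: mult.assoc)

lemma idx_Suc_Suc:
  assumes "2 * \<theta> = of_int c"
  shows "idx \<theta> (Suc (Suc k)) x = (idx \<theta> k x + c) div 3"
  unfolding idx_def coord_Suc_Suc half_Suc_Suc by (rule grid_index_coarsen[OF assms])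

lemma same_cell_Suc:
  assumes "2 * \<theta> = of_int c" "same_cell \<theta> k x y"
  shows "same_cell \<theta> (Suc k) x y"
  using assms by (simp add: same_cell_def idx_Suc_Suc)

lemma same_cell_mono:
  assumes "2 * \<theta> = of_int c" "same_cell \<theta> k x y" "k \<le> n"
  shows "same_cell \<theta> n x y"
  using assms(3,2) by (induction rule: dec_induct) (auto intro: same_cell_Suc[OF assms(1)])

text \<open>A pair gets its bound when its two cells merge; later joins preserve distances inside a
  child, so the bound survives up to level \<open>k\<close>.\<close>

lemma grid_tree:
  assumes c: "2 * \<theta> = of_int c"
    and fine: "\<And>x y. x \<in> P \<Longrightarrow> y \<in> P \<Longrightarrow> same_cell \<theta> 0 x y \<Longrightarrow> x = y"
    and V: "V = {x \<in> P. idx \<theta> k x = i \<and> idx \<theta> (Suc k) x = j}" "V \<noteq> {}"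
  shows "\<exists>E D eU eV. cell_tree (half k) (coord k) (coord (Suc k)) (ctr \<theta> k i) (ctr \<theta> (Suc k) j) V E D eU eV \<and>
    (\<forall>x\<in>V. \<forall>y\<in>V. \<forall>m<k. separated_by_both \<theta> m x y \<longrightarrow> D x y \<le> 4 * sqrt 26 * dist x y)"
  using V
proof (induction k arbitrary: i j V)
  case 0
  then obtain v where v: "v \<in> V" by blast
  have Vv: "V = {v}" using 0 v fine unfolding same_cell_def by auto
  have ij: "i = idx \<theta> 0 v" "j = idx \<theta> 1 v" using 0 v by auto
  have "\<bar>coord 0 v - ctr \<theta> 0 i\<bar> \<le> half 0" "\<bar>coord 1 v - ctr \<theta> 1 j\<bar> \<le> half 1"
    unfolding ij ctr_def idx_def by (rule grid_center_dist[OF half_pos])+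
  then have "cell_tree (half 0) (coord 0) (coord 1) (ctr \<theta> 0 i) (ctr \<theta> 1 j) {v} {} (\<lambda>_ _. 0)
      (\<lambda>_. v) (\<lambda>_. v)"
    using cell_tree_single[OF half_pos[of 0]] half_Suc[of 0] by simp
  then show ?case
    unfolding Vv by (intro exI[of _ "{}"] exI[of _ "\<lambda>_ _. 0"] exI[of _ "\<lambda>_. v"]) simp
next
  case (Suc k)
  define b' where "b' = half k"
  let ?S = "coord k" and ?L = "coord (Suc k)"
  let ?s = "ctr \<theta> (Suc (Suc k)) j" and ?l = "ctr \<theta> (Suc k) i"
  \<comment> \<open>The three solutions \<open>n\<close> of \<open>(n + c) div 3 = j\<close>, from
    left to right.\<close>
  define N where "N \<sigma> = 3 * j - c + (if \<sigma> = -1 then 0 else if \<sigma> = 0 then 1 else 2)" for \<sigma> :: real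
  define W where "W \<sigma> = {x \<in> P. idx \<theta> k x = N \<sigma> \<and> idx \<theta> (Suc k) x = i}" for \<sigma>
  have b': "0 < b'" unfolding b'_def by (rule half_pos)
  have cN: "ctr \<theta> k (N \<sigma>) = ?s + 2 * \<sigma> * b'" if "\<sigma> \<in> {-1, 0, 1}" for \<sigma>
    using grid_center_child[OF c, of "half k" "N \<sigma>" j] that
    unfolding ctr_def half_Suc_Suc b'_def N_def by auto
  have "\<forall>\<sigma>. \<exists>E D eU eV. W \<sigma> \<noteq> {} \<longrightarrow>
      cell_tree b' ?S ?L (ctr \<theta> k (N \<sigma>)) ?l (W \<sigma>) E D eU eV \<and>
      (\<forall>x\<in>W \<sigma>. \<forall>y\<in>W \<sigma>. \<forall>m<k. separated_by_both \<theta> m x y \<longrightarrow> D x y \<le> 4 * sqrt 26 * dist x y)"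
    using Suc.IH[OF W_def] unfolding b'_def by blast
  then obtain E D gU gV where child: "\<And>\<sigma>. W \<sigma> \<noteq> {} \<Longrightarrow>
      cell_tree b' ?S ?L (ctr \<theta> k (N \<sigma>)) ?l (W \<sigma>) (E \<sigma>) (D \<sigma>) (gU \<sigma>) (gV \<sigma>) \<and>
      (\<forall>x\<in>W \<sigma>. \<forall>y\<in>W \<sigma>. \<forall>m<k. separated_by_both \<theta> m x y \<longrightarrow> D \<sigma> x y \<le> 4 * sqrt 26 * dist x y)"
    by metis
  have ch: "W \<sigma> = {} \<or> cell_tree b' ?S ?L (?s + 2 * \<sigma> * b') ?l (W \<sigma>) (E \<sigma>) (D \<sigma>) (gU \<sigma>) (gV \<sigma>)"
    if "\<sigma> \<in> {-1, 0, 1}" for \<sigma> using child cN[OF that] by metis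
  have VW: "V = W (-1) \<union> W 0 \<union> W 1"
  proof -
    have "(n + c) div 3 = j \<longleftrightarrow> n = N (-1) \<or> n = N 0 \<or> n = N 1" for n
      unfolding N_def by auto
    then show ?thesis unfolding Suc.prems(1) W_def idx_Suc_Suc[OF c] by auto
  qed
  have disj: "W \<sigma> \<inter> W \<tau> = {}" if "\<sigma> \<in> {-1, 0, 1}" "\<tau> \<in> {-1, 0, 1}" "\<sigma> \<noteq> \<tau>" for \<sigma> \<tau>
    using that unfolding W_def N_def by auto
  obtain E' D' eU eV where
    ct: "cell_tree (half (Suc k)) ?L ?S ?l ?s V E' D' eU eV"
    and agree: "\<And>\<sigma> x y. \<sigma> \<in> {-1, 0, 1} \<Longrightarrow> x \<in> W \<sigma> \<Longrightarrow> y \<in> W \<sigma> \<Longrightarrow> D' x y = D \<sigma> x y"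
    and cross: "\<And>\<sigma> \<tau> x y. \<sigma> \<in> {-1, 0, 1} \<Longrightarrow> \<tau> \<in> {-1, 0, 1} \<Longrightarrow> \<sigma> < \<tau> \<Longrightarrow> x \<in> W \<sigma> \<Longrightarrow> y \<in> W \<tau> \<Longrightarrow>
      D' x y \<le> facing_cost ?S ?L b' (?s + 2 * \<sigma> * b') ?l (D \<sigma>) (gV \<sigma>) 1 x
        + (if \<tau> - \<sigma> = 2 then 9/2 * b' else 0)
        + facing_cost ?S ?L b' (?s + 2 * \<tau> * b') ?l (D \<tau>) (gV \<tau>) (-1) y"
    using cell_tree_join[OF coords_level b' half_Suc[of k, folded b'_def] ch disj Suc.prems(2)[unfolded VW]]
    unfolding VW by blast
  have sym: "D' x y = D' y x" if "x \<in> V" "y \<in> V" for x y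
    using mtree_dist_sym[OF cell_tree.mtree[OF ct]] that by blast
  have pair: "D' x y \<le> 4 * sqrt 26 * dist x y"
    if \<sigma>: "\<sigma> \<in> {-1, 0, 1}" and \<tau>: "\<tau> \<in> {-1, 0, 1}" and lt: "\<sigma> < \<tau>" and x: "x \<in> W \<sigma>" and y: "y \<in> W \<tau>"
      and sep: "\<not> same_cell (1/2 - \<theta>) k x y" for \<sigma> \<tau> x y
  proof -
    have cx: "cell_tree b' ?S ?L (?s + 2 * \<sigma> * b') ?l (W \<sigma>) (E \<sigma>) (D \<sigma>) (gU \<sigma>) (gV \<sigma>)"
      using ch[OF \<sigma>] x by auto
    have cy: "cell_tree b' ?S ?L (?s + 2 * \<tau> * b') ?l (W \<tau>) (E \<tau>) (D \<tau>) (gU \<tau>) (gV \<tau>)"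
      using ch[OF \<tau>] y by auto
    note pb = b' \<sigma> \<tau> lt cx x cy y cross[OF \<sigma> \<tau> lt x y]
    \<comment> \<open>Index \<open>Suc k\<close> concerns direction \<open>L\<close>, where siblings
      agree, so the center line is their axis; index \<open>k\<close> concerns the direction
      \<open>S\<close> in which siblings are lined up.\<close>
    consider "idx (1/2 - \<theta>) (Suc k) x \<noteq> idx (1/2 - \<theta>) (Suc k) y"
      | "idx (1/2 - \<theta>) k x \<noteq> idx (1/2 - \<theta>) k y" using sep unfolding same_cell_def by blast
    then show ?thesis
    proof cases
      case 1
      have "(?L x - ?l) * (?L y - ?l) \<le> 0"
        unfolding ctr_def using 1 x y unfolding idx_def W_def
        by (intro other_grid_straddles[OF half_pos c]) auto
      from straddling_pair_bound[OF pb this] show ?thesis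
        using linear_form_le_dist[OF coords_level] order_trans by blast
    next
      case 2
      have lin: "81/4 * \<bar>?S x - ?S y\<bar> \<le> 4 * sqrt 26 * dist x y"
        using linear_form_le_dist[OF plane_coords_commute[OF coords_level[of k]], of x y]
          abs_ge_zero[of "?L x - ?L y"] by argo
      have le: "?S x \<le> ?S y"
      proof -
        have "?S x \<le> ?s + 2 * \<sigma> * b' + b'" "?s + 2 * \<tau> * b' - b' \<le> ?S y"
          using cell_tree.box_S[OF cx x] cell_tree.box_S[OF cy y] by auto
        moreover have "2 * \<sigma> * b' + b' \<le> 2 * \<tau> * b' - b'" using \<sigma> \<tau> lt b' by auto
        ultimately show ?thesis by simp
      qed
      have "idx (1/2 - \<theta>) k x < idx (1/2 - \<theta>) k y"
      proof -
        have "idx (1/2 - \<theta>) k x \<le> idx (1/2 - \<theta>) k y"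
          unfolding idx_def grid_index_def using le half_pos[of k]
          by (intro floor_mono add_right_mono divide_right_mono) auto
        then show ?thesis using 2 by simp
      qed
      then obtain n where "?S x \<le> ctr \<theta> k n" "ctr \<theta> k n \<le> ?S y"
        using other_grid_separates[OF half_pos c] unfolding idx_def ctr_def by blast
      moreover have "ctr \<theta> k n = ?s + 2 * of_int (n - (3 * j - c + 1)) * b'"
        using grid_center_child[OF c] unfolding ctr_def half_Suc_Suc b'_def by simp
      ultimately have "D' x y \<le> 81/4 * \<bar>?S x - ?S y\<bar>"
        using separated_pair_bound[OF pb, of "n - (3 * j - c + 1)"] by simp
      then show ?thesis using lin by simp
    qed
  qed
  have "D' x y \<le> 4 * sqrt 26 * dist x y"
    if x: "x \<in> V" and y: "y \<in> V" and m: "m < Suc k" and sep: "separated_by_both \<theta> m x y" for x y m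
  proof -
    obtain \<sigma> \<tau> where \<sigma>: "\<sigma> \<in> {-1, 0, 1}" "x \<in> W \<sigma>" and \<tau>: "\<tau> \<in> {-1, 0, 1}" "y \<in> W \<tau>"
      using x y VW by blast
    show ?thesis
    proof (cases "m = k")
      case True
      then have ns: "\<not> same_cell \<theta> k x y" "\<not> same_cell (1/2 - \<theta>) k x y"
        using sep unfolding separated_by_both_def by auto
      then have "\<sigma> \<noteq> \<tau>" using \<sigma> \<tau> unfolding W_def same_cell_def by auto
      then consider "\<sigma> < \<tau>" | "\<tau> < \<sigma>" by linarith
      then show ?thesis
      proof cases
        case 1
        show ?thesis by (rule pair[OF \<sigma>(1) \<tau>(1) 1 \<sigma>(2) \<tau>(2) ns(2)])
      next
        case 2
        have "\<not> same_cell (1/2 - \<theta>) k y x" using ns(2) unfolding same_cell_def by auto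
        from pair[OF \<tau>(1) \<sigma>(1) 2 \<tau>(2) \<sigma>(2) this] show ?thesis
          using sym[OF x y] by (simp add: dist_commute)
      qed
    next
      case False
      then have mk: "m < k" using m by simp
      have "same_cell \<theta> k x y"
        using same_cell_mono[OF c, of "Suc m"] sep mk unfolding separated_by_both_def by simp
      then have "y \<in> W \<sigma>" using \<sigma> \<tau> unfolding W_def same_cell_def by auto
      then show ?thesis using agree[OF \<sigma>] child[of \<sigma>] \<sigma>(2) mk sep by auto
    qed
  qed
  then show ?case using ct unfolding coord_Suc_Suc by blast
qed

end

text \<open>In the unshifted grid \<open>0\<close> is a wall on every level, so points on opposite
  sides would never merge; this explains \<open>0 \<le> z\<close>. The shifted grid has walls at
  \<open>-h\<close> and \<open>h\<close>.\<close>

lemma grid_index_eq_0: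
  assumes "0 \<le> z" "z < h" "\<theta> \<in> {0, 1/2}"
  shows "grid_index \<theta> h z = 0"
proof -
  have "0 \<le> z / (2 * h)" "z / (2 * h) < 1/2" using assms by (auto simp: field_simps)
  then show ?thesis using assms(3) unfolding grid_index_def by (auto simp: floor_eq_iff)
qed

context plane_grid
begin

lemma two_grid_trees:
  assumes fine: "\<And>\<theta> x y. \<theta> \<in> {0, 1/2} \<Longrightarrow> x \<in> P \<Longrightarrow> y \<in> P \<Longrightarrow> same_cell \<theta> 0 x y \<Longrightarrow> x = y"
    and nonneg: "\<And>x. x \<in> P \<Longrightarrow> 0 \<le> X x \<and> 0 \<le> Y x"
    and bounded: "\<And>x. x \<in> P \<Longrightarrow> X x < R \<and> Y x < R"
    and ne: "P \<noteq> {}"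
  shows "\<exists>E1 D1 E2 D2. mtree P E1 D1 \<and> mtree P E2 D2 \<and>
    (\<forall>x\<in>P. \<forall>y\<in>P. D1 x y \<le> 4 * sqrt 26 * dist x y \<or> D2 x y \<le> 4 * sqrt 26 * dist x y)"
proof -
  have "1 < sqrt 3" by simp
  then obtain n where n: "R / b < sqrt 3 ^ n" using real_arch_pow by blast
  then have Rn: "R < half n" using b_pos by (simp add: half_def field_simps)
  also have "half n \<le> half (Suc n)"
    using half_Suc half_pos[of n] sqrt3_mult_bounds(1)[of "half n"] by simp
  finally have Rn': "R < half (Suc n)" .
  have top: "idx \<theta> n x = 0 \<and> idx \<theta> (Suc n) x = 0" if "\<theta> \<in> {0, 1/2}" "x \<in> P" for \<theta> x
    using nonneg[OF that(2)] bounded[OF that(2)] Rn Rn' that(1) unfolding idx_def coord_def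
    by (auto intro!: grid_index_eq_0)
  have tree: "\<exists>E D. mtree P E D \<and>
      (\<forall>x\<in>P. \<forall>y\<in>P. \<forall>m<n. separated_by_both \<theta> m x y \<longrightarrow> D x y \<le> 4 * sqrt 26 * dist x y)"
    if \<theta>: "\<theta> \<in> {0, 1/2}" for \<theta>
  proof -
    obtain c :: int where c: "2 * \<theta> = of_int c" using \<theta> by (auto intro: that[of 0] that[of 1])
    have "P = {x \<in> P. idx \<theta> n x = 0 \<and> idx \<theta> (Suc n) x = 0}" using top[OF \<theta>] by auto
    from grid_tree[OF c fine[OF \<theta>] this ne] show ?thesis using cell_tree.mtree by blast
  qed
  obtain E1 D1 where t1: "mtree P E1 D1"
      "\<And>x y m. x \<in> P \<Longrightarrow> y \<in> P \<Longrightarrow> m < n \<Longrightarrow> separated_by_both 0 m x y \<Longrightarrow> D1 x y \<le> 4 * sqrt 26 * dist x y"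
    using tree[of 0] by auto
  obtain E2 D2 where t2: "mtree P E2 D2"
      "\<And>x y m. x \<in> P \<Longrightarrow> y \<in> P \<Longrightarrow> m < n \<Longrightarrow> separated_by_both (1/2) m x y \<Longrightarrow> D2 x y \<le> 4 * sqrt 26 * dist x y"
    using tree[of "1/2"] by auto
  have c0: "2 * (0::real) = of_int 0" and c1: "2 * (1/2::real) = of_int 1" by auto
  have "D1 x y \<le> 4 * sqrt 26 * dist x y \<or> D2 x y \<le> 4 * sqrt 26 * dist x y"
    if x: "x \<in> P" and y: "y \<in> P" for x y
  proof (cases "x = y")
    case True
    then show ?thesis using mtree_dist_self[OF t1(1)] x by simp
  next
    case False
    have last: "\<exists>m<n. \<not> same_cell \<theta> m x y \<and> same_cell \<theta> (Suc m) x y"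
      if \<theta>: "\<theta> \<in> {0, 1/2}" and c: "2 * \<theta> = of_int c" for \<theta> c
    proof -
      have top': "same_cell \<theta> n x y" using top[OF \<theta>] x y by (simp add: same_cell_def)
      have "\<not> same_cell \<theta> 0 x y" using fine[OF \<theta> x y] False by blast
      then obtain m where "\<not> same_cell \<theta> m x y" "same_cell \<theta> (Suc m) x y"
        using last_before_change[of "\<lambda>m. \<not> same_cell \<theta> m x y" 0 n] top' by auto
      moreover from this have "m < n" using same_cell_mono[OF c top', of m] by (meson not_le)
      ultimately show ?thesis by blast
    qed
    obtain m1 where m1: "m1 < n" "\<not> same_cell 0 m1 x y" "same_cell 0 (Suc m1) x y"
      using last[OF _ c0] by auto
    obtain m2 where m2: "m2 < n" "\<not> same_cell (1/2) m2 x y" "same_cell (1/2) (Suc m2) x y"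
      using last[OF _ c1] by auto
    show ?thesis
    proof (cases "m1 \<le> m2")
      \<comment> \<open>Being in one cell is inherited by coarser levels, so the grid that merges
        later separates the points on the earlier level, too.\<close>
      case True
      then have "\<not> same_cell (1/2) m1 x y" using m2 same_cell_mono[OF c1] by blast
      then have "separated_by_both 0 m1 x y" using m1 by (simp add: separated_by_both_def)
      then show ?thesis using t1(2) x y m1 by blast
    next
      case False
      then have "\<not> same_cell 0 m2 x y" using m1 same_cell_mono[OF c0, of m2 x y m1] by auto
      then have "separated_by_both (1/2) m2 x y" using m2 by (simp add: separated_by_both_def)
      then show ?thesis using t2(2) x y m2 by blast
    qed
  qed
  then show ?thesis using t1(1) t2(1) by blast
qed

lemma same_cell_imp_close:
  assumes "same_cell \<theta> 0 x y"
  shows "dist x y \<le> 6 * b"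
proof -
  have "\<bar>coord k x - coord k y\<bar> \<le> 2 * half k" if "idx \<theta> k x = idx \<theta> k y" for k
  proof -
    let ?c = "grid_center \<theta> (half k) (idx \<theta> k x)"
    have "\<bar>coord k x - ?c\<bar> \<le> half k" unfolding idx_def by (rule grid_center_dist[OF half_pos])
    moreover have "\<bar>coord k y - ?c\<bar> \<le> half k"
      using grid_center_dist[OF half_pos, of "coord k y" \<theta> k] that unfolding idx_def by simp
    ultimately show ?thesis by linarith
  qed
  from this[of 0] this[of 1] assms have "\<bar>X x - X y\<bar> \<le> 2 * b" "\<bar>Y x - Y y\<bar> \<le> 2 * (sqrt 3 * b)"
    by (auto simp: same_cell_def coord_def half_def)
  moreover have "dist x y \<le> \<bar>X x - X y\<bar> + \<bar>Y x - Y y\<bar>"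
    using coords sqrt_sum_squares_le_sum_abs unfolding plane_coords_def by metis
  ultimately show ?thesis using sqrt3_mult_bounds[of b] b_pos by linarith
qed

end

lemma finite_uniformly_discrete:
  fixes P :: "'a::metric_space set"
  assumes "finite P"
  shows "\<exists>d>0. \<forall>x\<in>P. \<forall>y\<in>P. x \<noteq> y \<longrightarrow> d \<le> dist x y"
proof -
  \<comment> \<open>The element \<open>1\<close> keeps the set nonempty when \<open>P\<close> has at
    most one point.\<close>
  let ?A = "insert 1 ((\<lambda>(x, y). dist x y) ` {(x, y) \<in> P \<times> P. x \<noteq> y})"
  have "finite ?A" using assms by (auto intro: finite_subset[of _ "P \<times> P"])
  then have "0 < Min ?A" "\<forall>a\<in>?A. Min ?A \<le> a" by auto
  then show ?thesis by (intro exI[of _ "Min ?A"]) auto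
qed

theorem theorem1p2:
  fixes P :: "(real ^ 2) set"
  assumes "finite P"
  shows "\<exists>T1 T2. Metric_space.spanning_tree_cover P dist (4 * sqrt 26) {T1, T2}"
proof -
  interpret Metric_space P dist by (rule Metric_space_dist)
  have "1 \<le> sqrt 26" by simp
  then have t: "1 \<le> 4 * sqrt 26" by linarith
  show ?thesis
  proof (cases "P = {}")
    case True
    have "spanning_tree_cover (4 * sqrt 26) {metric_graph {} {}, metric_graph {} {}}"
      unfolding spanning_tree_cover_def tree_cover_def using t empty_metric_graph True by auto
    then show ?thesis by blast
  next
    case False
    obtain d where d: "0 < d" "\<And>x y. x \<in> P \<Longrightarrow> y \<in> P \<Longrightarrow> x \<noteq> y \<Longrightarrow> d \<le> dist x y"
      using finite_uniformly_discrete[OF assms] by blast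
    obtain M where M: "\<And>x. x \<in> P \<Longrightarrow> norm x \<le> M"
      using finite_imp_bounded[OF assms] by (auto simp: bounded_iff)
    \<comment> \<open>The translation makes all coordinates nonnegative, so that \<open>P\<close>
      ends up in one cell of either grid.\<close>
    define X Y where "X p = p $ 1 + M" and "Y p = p $ 2 + M" for p :: "real ^ 2"
    \<comment> \<open>Two points in one cell of level \<open>0\<close> are at most
      \<open>6 * b\<close> apart, so \<open>b = d / 7\<close> isolates the points of
      \<open>P\<close>.\<close>
    interpret plane_grid X Y "d / 7" P
    proof
      show "plane_coords X Y"
        by (simp add: plane_coords_def X_def Y_def dist_vec_def L2_set_def sum_2 dist_real_def)
      show "0 < d / 7" using d by simp
    qed
    have c: "\<bar>x $ 1\<bar> \<le> M" "\<bar>x $ 2\<bar> \<le> M" if "x \<in> P" for x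
      using M[OF that] component_le_norm_cart[of x] order_trans by blast+
    have "\<exists>E1 D1 E2 D2. mtree P E1 D1 \<and> mtree P E2 D2 \<and>
      (\<forall>x\<in>P. \<forall>y\<in>P. D1 x y \<le> 4 * sqrt 26 * dist x y \<or> D2 x y \<le> 4 * sqrt 26 * dist x y)"
    proof (rule two_grid_trees)
      show "x = y" if "x \<in> P" "y \<in> P" "same_cell \<theta> 0 x y" for \<theta> x y
        using same_cell_imp_close[OF that(3)] d(1) d(2)[OF that(1,2)] by fastforce
      show "0 \<le> X x \<and> 0 \<le> Y x" if "x \<in> P" for x using c[OF that] by (auto simp: X_def Y_def)
      show "X x < 2 * M + 1 \<and> Y x < 2 * M + 1" if "x \<in> P" for x
        using c[OF that] by (auto simp: X_def Y_def)
    qed (rule False)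
    then obtain E1 D1 E2 D2 where m1: "mtree P E1 D1" and m2: "mtree P E2 D2"
      and le: "\<And>x y. x \<in> P \<Longrightarrow> y \<in> P \<Longrightarrow>
        D1 x y \<le> 4 * sqrt 26 * dist x y \<or> D2 x y \<le> 4 * sqrt 26 * dist x y" by blast
    let ?T1 = "metric_graph P E1" and ?T2 = "metric_graph P E2"
    have "\<exists>T\<in>{?T1, ?T2}. ereal (dist x y) \<le> tree_dist T x y \<and>
        tree_dist T x y \<le> ereal (4 * sqrt 26 * dist x y)" if xy: "x \<in> P" "y \<in> P" for x y
      using le[OF xy]
    proof
      assume "D1 x y \<le> 4 * sqrt 26 * dist x y"
      then have "ereal (D1 x y) \<le> ereal (4 * sqrt 26 * dist x y)" by simp
      then show ?thesis using mtree_metric_graph(2,3)[OF m1 xy] order_trans by blast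
    next
      assume "D2 x y \<le> 4 * sqrt 26 * dist x y"
      then have "ereal (D2 x y) \<le> ereal (4 * sqrt 26 * dist x y)" by simp
      then show ?thesis using mtree_metric_graph(2,3)[OF m2 xy] order_trans by blast
    qed
    then have "spanning_tree_cover (4 * sqrt 26) {?T1, ?T2}"
      unfolding spanning_tree_cover_def tree_cover_def
      using t mtree_metric_graph(1)[OF m1] mtree_metric_graph(1)[OF m2] by auto
    then show ?thesis by blast
  qed
qed

end
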